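(* Let $\mathbb F$ be a field, $G$ a digraph without multisquares, and $n\ge0$. (1) If $\mathrm{char}(\mathbb F)=2$, then (the images in $\Omega^n(G;\mathbb F)=(\mathbb FG/T)^n$ of) a complete set of representatives of thick $\mathcal S_n$-classes is a basis of $\Omega^n(G;\mathbb F)$. (2) If $\mathrm{char}(\mathbb F)\ne2$, then (the images in $\Omega^n(G;\mathbb F)=(\mathbb FG/T)^n$ of) a complete set of representatives of thick bipartite $\mathcal S_n$-classes is a basis of $\Omega^n(G;\mathbb F)$.
   Context: A digraph $G$ consists of a finite set $V(G)$ of vertices and a set of arrows, which are ordered pairs of distinct vertices. An $n$-path is a sequence $(p_0,\dots,p_n)$ of vertices such that $(p_i,p_{i+1})$ is an arrow for $0\le i\le n-1$. $d(x,y)$ is the directed distance; $d(x,y)=2$ means that $x\ne y$, there is no arrow $x\to y$, and there is a $2$-path from $x$ to $y$. $G$ has no multisquares if for all $x,y$ with $d(x,y)=2$ there are at most two $2$-paths from $x$ to $y$. Path cochains: $\mathcal R^n(G;\mathbb F)$ has basis $e^{x_0,\dots,x_n}$ ($x_i\in V(G)$, $x_i\neq x_{i+1}$), with $\partial(e^{x_0,\dots,x_n})=\sum_{i=0}^{n+1}\sum_{v\in V(G)}(-1)^ie^{x_0,\dots,x_{i-1},v,x_i,\dots,x_n}$ (terms with equal consecutive indices cancel). $\mathcal N^n$ is spanned by the $e^{x_0,\dots,x_n}$ for which $(x_0,\dots,x_n)$ is not a path, $\mathcal J^n=\mathcal N^n+\partial(\mathcal N^{n-1})$, and $\Omega^n(G;\mathbb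 F)=\mathcal R^n/\mathcal J^n$. $\mathbb FG$ is the path algebra with basis all paths of length $n\ge0$, graded by length, with concatenation product (zero if endpoints do not match). $T\triangleleft\mathbb FG$ is the two-sided ideal generated by $t_{x,y}=\sum_v(x,v,y)$ (sum over all $2$-paths from $x$ to $y$) for all $x,y$ with $d(x,y)=2$. One identifies $\Omega^n(G;\mathbb F)$ with $(\mathbb FG/T)^n$ via the known isomorphism sending the class of $e^{x_0,\dots,x_n}$ to the class of the path $(x_0,\dots,x_n)$. Two distinct $n$-paths $p,q$ differ by a short move if there is $1\le i\le n-1$ with $p_j=q_j$ for all $j\ne i$ and $d(p_{i-1},p_{i+1})=2$. The graph $\mathcal S_n$ is the undirected simple graph whose vertices are the $n$-paths of $G$, with an edge between two distinct $n$-paths that differ by a short move. Its connected components are the $\mathcal S_n$-classes. A pair $(x,y)$ with $d(x,y)=2$ is thin if there is exactly one $2$-path from $x$ to $y$. An $n$-path $p$ is thin if some pair $(p_{i-1},p_{i+1})$, $0<i<n$, is thin. An $\mathcal S_n$-class is thin if it contains a thin path, and thick otherwise. An $\mathcal S_n$-class is bipartite if it is bipartite as a graph. A complete set of representatives contains exactly one path from each class. *)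

theory Defs
  imports
    "Graph_Theory.Pair_Digraph"
    "HOL-Algebra.QuotRing"
    "HOL-Algebra.Module"
    "HOL-Library.Poly_Mapping"
begin

section \<open>Paths\<close>

text \<open>
  A sequence \<open>(x\<^sub>0, \<dots>, x\<^sub>n)\<close> of vertices is the list \<open>[x\<^sub>0, \<dots>, x\<^sub>n]\<close>, of length \<open>n + 1\<close>.
  Digraphs are those of \<^locale>\<open>pair_digraph\<close>: finite, with arrows being ordered pairs of
  distinct vertices.
\<close>

definition npaths :: "'v pair_pre_digraph \<Rightarrow> nat \<Rightarrow> 'v list set" where
  "npaths G n = {p. length p = Suc n \<and> set p \<subseteq> pverts G \<and>
     (\<forall>i<n. (p ! i, p ! Suc i) \<in> parcs G)}"

definition two_paths :: "'v pair_pre_digraph \<Rightarrow> 'v \<Rightarrow> 'v \<Rightarrow> 'v list set" where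
  "two_paths G x y = {p \<in> npaths G 2. p ! 0 = x \<and> p ! 2 = y}"

definition dist_two :: "'v pair_pre_digraph \<Rightarrow> 'v \<Rightarrow> 'v \<Rightarrow> bool" where
  "dist_two G x y \<longleftrightarrow> x \<noteq> y \<and> (x, y) \<notin> parcs G \<and> two_paths G x y \<noteq> {}"

definition no_multisquares :: "'v pair_pre_digraph \<Rightarrow> bool" where
  "no_multisquares G \<longleftrightarrow> (\<forall>x y. dist_two G x y \<longrightarrow> card (two_paths G x y) \<le> 2)"


section \<open>Vector spaces, quotients and bases\<close>

text \<open>
  The free vector space on \<open>B\<close>. The multiplicative fields of the record play no role here.
\<close>

definition free_space :: "'b set \<Rightarrow> ('f::field, 'b \<Rightarrow>\<^sub>0 'f) module" where
  "free_space B = \<lparr>carrier = {f. Poly_Mapping.keys f \<subseteq> B}, mult = undefined, one = undefined,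
     zero = 0, add = (+), smult = (\<lambda>c. Poly_Mapping.map ((*) c))\<rparr>"

abbreviation basis_vec :: "'b \<Rightarrow> ('b \<Rightarrow>\<^sub>0 'f::field)" where
  "basis_vec b \<equiv> Poly_Mapping.single b 1"

text \<open>
  \<^const>\<open>FactRing\<close> extended by scalar multiplication \<open>c \<odot> (J + x) = J + c \<odot> x\<close>. If only the
  vector space structure of \<open>M\<close> is meaningful, then the same holds for the quotient.
\<close>

definition quot_space :: "('f, 'm) module \<Rightarrow> 'm set \<Rightarrow> ('f, 'm set) module" where
  "quot_space M J = ring.extend (M Quot J)
     \<lparr>smult = (\<lambda>c X. \<Union>x\<in>X. J +>\<^bsub>M\<^esub> (c \<odot>\<^bsub>M\<^esub> x))\<rparr>"

definition is_basis :: "('f::field, 'm) module \<Rightarrow> 'i set \<Rightarrow> ('i \<Rightarrow> 'm) \<Rightarrow> bool" where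
  "is_basis M I b \<longleftrightarrow>
     b \<in> I \<rightarrow> carrier M \<and>
     (\<forall>J c. finite J \<and> J \<subseteq> I \<and> (\<Oplus>\<^bsub>M\<^esub>i\<in>J. c i \<odot>\<^bsub>M\<^esub> b i) = \<zero>\<^bsub>M\<^esub> \<longrightarrow> (\<forall>i\<in>J. c i = 0)) \<and>
     (\<forall>x\<in>carrier M. \<exists>J c. finite J \<and> J \<subseteq> I \<and> x = (\<Oplus>\<^bsub>M\<^esub>i\<in>J. c i \<odot>\<^bsub>M\<^esub> b i))"


section \<open>Path cochains\<close>

definition regular_seqs :: "'v pair_pre_digraph \<Rightarrow> nat \<Rightarrow> 'v list set" where
  "regular_seqs G n = {x. length x = Suc n \<and> set x \<subseteq> pverts G \<and> (\<forall>i<n. x ! i \<noteq> x ! Suc i)}"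

definition R_space :: "'v pair_pre_digraph \<Rightarrow> nat \<Rightarrow> ('f::field, 'v list \<Rightarrow>\<^sub>0 'f) module" where
  "R_space G n = free_space (regular_seqs G n)"

text \<open>
  The sum is taken in the free vector space on all vertex sequences. On regular sequences its
  values are again combinations of regular sequences: inserting \<open>v = x\<^sub>j\<close> just before and just
  after \<open>x\<^sub>j\<close> gives the same sequence with opposite signs.
\<close>

definition coboundary :: "'v pair_pre_digraph \<Rightarrow> ('v list \<Rightarrow>\<^sub>0 'f::field) \<Rightarrow> ('v list \<Rightarrow>\<^sub>0 'f)" where
  "coboundary G f = (\<Sum>x\<in>Poly_Mapping.keys f. \<Sum>i\<le>length x. \<Sum>v\<in>pverts G.
     Poly_Mapping.single (take i x @ v # drop i x) ((-1) ^ i * Poly_Mapping.lookup f x))"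

definition N_space :: "'v pair_pre_digraph \<Rightarrow> nat \<Rightarrow> ('v list \<Rightarrow>\<^sub>0 'f::field) set" where
  "N_space G n = {f. Poly_Mapping.keys f \<subseteq> regular_seqs G n - npaths G n}"

text \<open>\<open>\<N>\<^sup>-\<^sup>1 = 0\<close>, so \<open>\<J>\<^sup>0 = \<N>\<^sup>0\<close>.\<close>

fun J_space :: "'v pair_pre_digraph \<Rightarrow> nat \<Rightarrow> ('v list \<Rightarrow>\<^sub>0 'f::field) set" where
  "J_space G 0 = N_space G 0"
| "J_space G (Suc n) = {f + coboundary G g | f g. f \<in> N_space G (Suc n) \<and> g \<in> N_space G n}"

definition Omega :: "'v pair_pre_digraph \<Rightarrow> nat \<Rightarrow> ('f::field, ('v list \<Rightarrow>\<^sub>0 'f) set) module" where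
  "Omega G n = quot_space (R_space G n) (J_space G n)"

definition Omega_class :: "'v pair_pre_digraph \<Rightarrow> nat \<Rightarrow> 'v list \<Rightarrow> ('v list \<Rightarrow>\<^sub>0 'f::field) set" where
  "Omega_class G n x = J_space G n +>\<^bsub>R_space G n\<^esub> basis_vec x"


section \<open>The path algebra and its quotient\<close>

text \<open>
  Paths of length 0 are the lists \<open>[v]\<close>; they are orthogonal idempotents with sum the unit.
\<close>

definition path_mult :: "('v list \<Rightarrow>\<^sub>0 'f::field) \<Rightarrow> ('v list \<Rightarrow>\<^sub>0 'f) \<Rightarrow> ('v list \<Rightarrow>\<^sub>0 'f)" where
  "path_mult f g = (\<Sum>p\<in>Poly_Mapping.keys f. \<Sum>q\<in>Poly_Mapping.keys g.
     if last p = hd q then Poly_Mapping.single (p @ tl q) (Poly_Mapping.lookup f p * Poly_Mapping.lookup g q) else 0)"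

definition path_algebra :: "'v pair_pre_digraph \<Rightarrow> ('f::field, 'v list \<Rightarrow>\<^sub>0 'f) module" where
  "path_algebra G = (free_space (\<Union>n. npaths G n))
     \<lparr>mult := path_mult, one := (\<Sum>v\<in>pverts G. basis_vec [v])\<rparr>"

definition T_gen :: "'v pair_pre_digraph \<Rightarrow> 'v \<Rightarrow> 'v \<Rightarrow> ('v list \<Rightarrow>\<^sub>0 'f::field)" where
  "T_gen G x y = (\<Sum>p\<in>two_paths G x y. basis_vec p)"

definition T_ideal :: "'v pair_pre_digraph \<Rightarrow> ('v list \<Rightarrow>\<^sub>0 'f::field) set" where
  "T_ideal G = Idl\<^bsub>path_algebra G :: ('f, 'v list \<Rightarrow>\<^sub>0 'f) module\<^esub> {T_gen G x y | x y. dist_two G x y}"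

definition T_class :: "'v pair_pre_digraph \<Rightarrow> ('v list \<Rightarrow>\<^sub>0 'f::field) \<Rightarrow> ('v list \<Rightarrow>\<^sub>0 'f) set" where
  "T_class G f = T_ideal G +>\<^bsub>path_algebra G :: ('f, 'v list \<Rightarrow>\<^sub>0 'f) module\<^esub> f"

text \<open>The homogeneous part of degree \<open>n\<close> of the graded algebra \<open>\<F>G/T\<close>.\<close>

definition path_quotient :: "'v pair_pre_digraph \<Rightarrow> nat \<Rightarrow> ('f::field, ('v list \<Rightarrow>\<^sub>0 'f) set) module" where
  "path_quotient G n = (quot_space (path_algebra G) (T_ideal G))
     \<lparr>carrier := T_class G ` {f. Poly_Mapping.keys f \<subseteq> npaths G n}\<rparr>"


section \<open>Short moves\<close>

text \<open>The edges of \<open>\<S>\<^sub>n\<close>, as a symmetric irreflexive relation.\<close>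

definition short_moves :: "'v pair_pre_digraph \<Rightarrow> nat \<Rightarrow> 'v list rel" where
  "short_moves G n = {(p, q). p \<in> npaths G n \<and> q \<in> npaths G n \<and> p \<noteq> q \<and>
     (\<exists>i. 0 < i \<and> i < n \<and> (\<forall>j\<le>n. j \<noteq> i \<longrightarrow> p ! j = q ! j) \<and>
        dist_two G (p ! (i - 1)) (p ! (i + 1)))}"

definition S_classes :: "'v pair_pre_digraph \<Rightarrow> nat \<Rightarrow> 'v list set set" where
  "S_classes G n = npaths G n // (short_moves G n)\<^sup>*"

definition thin_pair :: "'v pair_pre_digraph \<Rightarrow> 'v \<Rightarrow> 'v \<Rightarrow> bool" where
  "thin_pair G x y \<longleftrightarrow> dist_two G x y \<and> card (two_paths G x y) = 1"

definition thin_path :: "'v pair_pre_digraph \<Rightarrow> nat \<Rightarrow> 'v list \<Rightarrow> bool" where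
  "thin_path G n p \<longleftrightarrow> (\<exists>i. 0 < i \<and> i < n \<and> thin_pair G (p ! (i - 1)) (p ! (i + 1)))"

definition thick_class :: "'v pair_pre_digraph \<Rightarrow> nat \<Rightarrow> 'v list set \<Rightarrow> bool" where
  "thick_class G n C \<longleftrightarrow> \<not> (\<exists>p\<in>C. thin_path G n p)"

definition bipartite_class :: "'v pair_pre_digraph \<Rightarrow> nat \<Rightarrow> 'v list set \<Rightarrow> bool" where
  "bipartite_class G n C \<longleftrightarrow> (\<exists>A B. A \<union> B = C \<and> A \<inter> B = {} \<and>
     short_moves G n \<inter> A \<times> A = {} \<and> short_moves G n \<inter> B \<times> B = {})"

definition complete_reps :: "'a set set \<Rightarrow> 'a set \<Rightarrow> bool" where
  "complete_reps \<C> P \<longleftrightarrow> P \<subseteq> \<Union>\<C> \<and> (\<forall>C\<in>\<C>. \<exists>!p. p \<in> P \<inter> C)"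

end

theory Submission
  imports Defs
begin

text \<open>
  Modulo \<open>T\<close>, as well as modulo \<open>\<J>\<^sup>n\<close>, the relations among \<open>n\<close>-paths are the sums over all
  ways of filling in the middle vertex of a pair \<open>(p\<^sub>i\<^sub>-\<^sub>1, p\<^sub>i\<^sub>+\<^sub>1)\<close> at distance two. Without
  multisquares, such a relation reads \<open>p \<equiv> 0\<close> for a thin path or \<open>p + q \<equiv> 0\<close> for a short
  move. So all paths of a class agree up to sign, and they vanish in a thin class, and, when
  \<open>2 \<noteq> 0\<close>, along an odd cycle. Conversely, the sign of a bipartition of a thick class (the
  constant 1 in characteristic two) is a linear functional that annihilates all relations, which
  separates the representatives.
\<close>

section \<open>Linear algebra over finitely supported functions\<close>

text \<open>The exact extent of \<open>J\<close> is hard to grasp: \<open>T_ideal G\<close> is a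
  generated ideal with no formula for its elements, and coboundaries of non-paths mix several kinds
  of sequences. Hence \<open>J\<close> is only bounded from two sides. It contains every two-path
  relation among n-paths, which gives spanning, and it is killed by every balanced functional that
  vanishes off the n-paths, which gives independence. Both quotients are treated in parallel through
  these two bounds. For \<open>T_ideal G\<close> the second bound comes from minimality, as the
  common kernel of the balanced functionals is itself an ideal. For \<open>J_space G n\<close> it
  comes from a combinatorial fact: inserting a vertex into a non-path can give a path only by
  filling a gap, a pair of consecutive vertices without an arrow, and all paths obtained this way
  carry the same sign.\<close>

abbreviation scale :: "'f::field \<Rightarrow> ('b \<Rightarrow>\<^sub>0 'f) \<Rightarrow> ('b \<Rightarrow>\<^sub>0 'f)" where
  "scale c \<equiv> Poly_Mapping.map ((*) c)"

lemma lookup_scale [simp]: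
  "Poly_Mapping.lookup (scale c f) k = c * Poly_Mapping.lookup f k"
  by (simp add: map.rep_eq when_def)

interpretation pm: Vector_Spaces.vector_space "scale :: 'f::field \<Rightarrow> ('b \<Rightarrow>\<^sub>0 'f) \<Rightarrow> ('b \<Rightarrow>\<^sub>0 'f)"
  by unfold_locales (auto intro!: poly_mapping_eqI simp: lookup_add algebra_simps)

lemma keys_scale: "Poly_Mapping.keys (scale c f) \<subseteq> Poly_Mapping.keys f"
  by (auto simp: in_keys_iff)

lemma subspace_keys: "pm.subspace {f :: 'b \<Rightarrow>\<^sub>0 'f::field. Poly_Mapping.keys f \<subseteq> B}"
  unfolding pm.subspace_def
proof (intro conjI ballI allI)
  show "f + g \<in> {f. Poly_Mapping.keys f \<subseteq> B}" "scale c f \<in> {f. Poly_Mapping.keys f \<subseteq> B}"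
    if "f \<in> {f. Poly_Mapping.keys f \<subseteq> B}" "g \<in> {f. Poly_Mapping.keys f \<subseteq> B}"
    for f g :: "'b \<Rightarrow>\<^sub>0 'f" and c
    using that keys_add[of f g] keys_scale[of c f] by auto
qed simp

lemma poly_mapping_sum_singles:
  "f = (\<Sum>k\<in>Poly_Mapping.keys f. Poly_Mapping.single k (Poly_Mapping.lookup f k))"
  by (rule poly_mapping_eqI) (simp add: lookup_sum lookup_single when_def in_keys_iff)

text \<open>Additivity forces \<open>F 0 = 0\<close>, which also settles infinite \<open>S\<close>,
  whose sums are 0 by convention.\<close>

lemma additive_sum:
  assumes "\<And>f g. F (f + g) = (F f + F g :: 'c::ab_group_add)"
  shows "F (sum h S) = (\<Sum>i\<in>S. F (h i))"
proof -
  have "F 0 = F 0 + F 0" using assms[of 0 0] by simp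
  then have "F 0 = 0" by simp
  then show ?thesis using assms by (induction S rule: infinite_finite_induct) auto
qed

text \<open>The linear functional with value \<open>e k\<close> on the basis vector of
  \<open>k\<close>. Any function \<open>e\<close> is allowed because \<open>f\<close> has finite
  support.\<close>

definition pairing :: "('b \<Rightarrow> 'f::field) \<Rightarrow> ('b \<Rightarrow>\<^sub>0 'f) \<Rightarrow> 'f" where
  "pairing e f = (\<Sum>k\<in>Poly_Mapping.keys f. Poly_Mapping.lookup f k * e k)"

lemma pairing_single [simp]: "pairing e (Poly_Mapping.single k a) = a * e k"
  by (simp add: pairing_def)

lemma pairing_zero [simp]: "pairing e 0 = 0"
  by (simp add: pairing_def)

lemma pairing_add: "pairing e (f + g) = pairing e f + pairing e g"
  unfolding pairing_def by (rule setsum_keys_plus_distrib) (auto simp: algebra_simps)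

lemma pairing_sum: "pairing e (sum h S) = (\<Sum>i\<in>S. pairing e (h i))"
  by (rule additive_sum[OF pairing_add])

lemma pairing_scale: "pairing e (scale c f) = c * pairing e f"
proof -
  have "pairing e (scale c f)
      = pairing e (scale c (\<Sum>k\<in>Poly_Mapping.keys f. Poly_Mapping.single k (Poly_Mapping.lookup f k)))"
    by (simp only: poly_mapping_sum_singles[symmetric])
  also have "\<dots> = c * pairing e f"
    by (simp add: pm.scale_sum_right pairing_sum)
       (simp add: pairing_def sum_distrib_left mult.assoc)
  finally show ?thesis .
qed

lemma pairing_eq_0:
  assumes "\<And>k. k \<in> Poly_Mapping.keys f \<Longrightarrow> e k = 0"
  shows "pairing e f = 0"
  unfolding pairing_def by (rule sum.neutral) (use assms in auto)

lemma subspace_supportI: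
  assumes "pm.subspace J" "\<And>k. k \<in> Poly_Mapping.keys f \<Longrightarrow> basis_vec k \<in> J"
  shows "f \<in> J"
proof -
  have "Poly_Mapping.single k (Poly_Mapping.lookup f k) \<in> J" if "k \<in> Poly_Mapping.keys f" for k
    using pm.subspace_scale[OF assms(1) assms(2)[OF that], of "Poly_Mapping.lookup f k"] by simp
  then show ?thesis
    by (subst poly_mapping_sum_singles) (intro pm.subspace_sum assms(1))
qed

subsection \<open>Bases of quotient spaces\<close>

text \<open>The carrier of \<open>Q\<close> is the set of cosets of members of \<open>U\<close>, and
  \<open>U\<close> is not assumed to contain \<open>J\<close>. This covers both the full quotient of
  cochains and a homogeneous part, where elements of degree n represent cosets of the whole
  ideal.\<close>

lemma is_basis_quotI:
  fixes M :: "('f::field, 'b \<Rightarrow>\<^sub>0 'f) module" and Q :: "('f, ('b \<Rightarrow>\<^sub>0 'f) set) module"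
  assumes M: "add M = (+)" "smult M = scale"
    and Q: "carrier Q = (\<lambda>f. J +>\<^bsub>M\<^esub> f) ` U" "add Q = set_add M" "zero Q = J"
      "smult Q = (\<lambda>c X. \<Union>x\<in>X. J +>\<^bsub>M\<^esub> (c \<odot>\<^bsub>M\<^esub> x))"
    and J: "pm.subspace J" and U: "pm.subspace U"
    and b: "b \<in> I \<rightarrow> U"
    and indep: "\<And>S c i. finite S \<Longrightarrow> S \<subseteq> I \<Longrightarrow> (\<Sum>i\<in>S. scale (c i) (b i)) \<in> J \<Longrightarrow> i \<in> S \<Longrightarrow> c i = 0"
    and span: "\<And>f. f \<in> U \<Longrightarrow> \<exists>S c. finite S \<and> S \<subseteq> I \<and> f - (\<Sum>i\<in>S. scale (c i) (b i)) \<in> J"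
  shows "is_basis Q I (\<lambda>i. J +>\<^bsub>M\<^esub> b i)"
proof -
  define cl where "cl f = J +>\<^bsub>M\<^esub> f" for f
  have cl: "cl f = (\<lambda>h. h + f) ` J" for f
    by (auto simp: cl_def a_r_coset_def r_coset_def M)
  have mem: "g \<in> cl f \<longleftrightarrow> g - f \<in> J" for f g
    unfolding cl by (auto simp: image_iff intro: bexI[of _ "g - f"])
  have cl_eq: "cl f = cl g \<longleftrightarrow> f - g \<in> J" for f g
  proof
    assume "cl f = cl g"
    moreover have "f \<in> cl f" using J by (simp add: mem pm.subspace_0)
    ultimately show "f - g \<in> J" by (simp add: mem)
  next
    assume fg: "f - g \<in> J"
    have "h - f \<in> J \<longleftrightarrow> h - g \<in> J" for h
      using pm.subspace_add[OF J _ fg, of "h - f"] pm.subspace_diff[OF J _ fg, of "h - g"]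
      by (auto simp: algebra_simps)
    then show "cl f = cl g" by (auto simp: mem)
  qed
  have add: "cl f \<oplus>\<^bsub>Q\<^esub> cl g = cl (f + g)" for f g
  proof -
    have "h \<in> cl f \<oplus>\<^bsub>Q\<^esub> cl g \<longleftrightarrow> (\<exists>a\<in>cl f. \<exists>b\<in>cl g. h = a + b)" for h
      by (auto simp: Q set_add_def set_mult_def M)
    moreover have "(\<exists>a\<in>cl f. \<exists>b\<in>cl g. h = a + b) \<longleftrightarrow> h - (f + g) \<in> J" for h
    proof
      assume "\<exists>a\<in>cl f. \<exists>b\<in>cl g. h = a + b"
      then obtain a b where "a - f \<in> J" "b - g \<in> J" "h = a + b" by (auto simp: mem)
      then show "h - (f + g) \<in> J"
        using pm.subspace_add[OF J, of "a - f" "b - g"] by (simp add: algebra_simps)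
    next
      assume "h - (f + g) \<in> J"
      then show "\<exists>a\<in>cl f. \<exists>b\<in>cl g. h = a + b"
        by (intro bexI[of _ "h - g"] bexI[of _ g])
           (auto simp: mem algebra_simps pm.subspace_0[OF J])
    qed
    ultimately show ?thesis by (auto simp: mem)
  qed
  have smult: "c \<odot>\<^bsub>Q\<^esub> cl f = cl (scale c f)" for c f
  proof -
    \<comment> \<open>Scalar multiplication on the quotient is a union over representatives; it
      collapses because all its members are one coset.\<close>
    have "cl (scale c h) = cl (scale c f)" if "h \<in> cl f" for h
      using pm.subspace_scale[OF J, of "h - f" c] that
      by (simp add: cl_eq mem pm.scale_right_diff_distrib)
    moreover have "f \<in> cl f" using J by (simp add: mem pm.subspace_0)
    ultimately have "(\<Union>h\<in>cl f. cl (scale c h)) = cl (scale c f)" by blast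
    then show ?thesis by (simp add: Q M cl_def)
  qed
  have zero: "\<zero>\<^bsub>Q\<^esub> = cl 0" by (auto simp: Q cl)
  have carr: "carrier Q = cl ` U" by (simp add: Q cl_def)
  \<comment> \<open>A commutative monoid is what the recursion for finite sums in \<open>Q\<close>
    asks for.\<close>
  interpret abelian_monoid Q
    by (rule abelian_monoidI)
       (auto simp: carr add zero ac_simps pm.subspace_add[OF U] pm.subspace_0[OF U])
  have fsum: "(\<Oplus>\<^bsub>Q\<^esub>i\<in>S. c i \<odot>\<^bsub>Q\<^esub> cl (b i)) = cl (\<Sum>i\<in>S. scale (c i) (b i))"
    if "finite S" "S \<subseteq> I" for S c
    using that
  proof (induction S rule: finite_induct)
    case empty
    then show ?case by (simp add: zero)
  next
    case (insert i S)
    have *: "cl (scale (c i) (b i)) \<in> carrier Q" if "i \<in> I" for i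
      using b that pm.subspace_scale[OF U] by (auto simp: carr)
    show ?case
      using insert * by (subst finsum_insert) (auto simp: smult add)
  qed
  have "is_basis Q I (\<lambda>i. cl (b i))"
    unfolding is_basis_def
  proof (intro conjI allI impI ballI)
    show "(\<lambda>i. cl (b i)) \<in> I \<rightarrow> carrier Q"
      using b by (auto simp: carr)
  next
    fix S c i
    assume "finite S \<and> S \<subseteq> I \<and> (\<Oplus>\<^bsub>Q\<^esub>i\<in>S. c i \<odot>\<^bsub>Q\<^esub> cl (b i)) = \<zero>\<^bsub>Q\<^esub>" "i \<in> S"
    then show "c i = 0"
      using indep[of S c i] by (auto simp: fsum zero cl_eq)
  next
    fix X assume "X \<in> carrier Q"
    then obtain f where f: "f \<in> U" "X = cl f" by (auto simp: carr)
    from span[OF f(1)] obtain S c where "finite S" "S \<subseteq> I" "f - (\<Sum>i\<in>S. scale (c i) (b i)) \<in> J"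
      by blast
    then show "\<exists>S c. finite S \<and> S \<subseteq> I \<and> X = (\<Oplus>\<^bsub>Q\<^esub>i\<in>S. c i \<odot>\<^bsub>Q\<^esub> cl (b i))"
      by (intro exI[of _ S] exI[of _ c]) (auto simp: fsum f cl_eq)
  qed
  then show ?thesis by (simp add: cl_def)
qed

section \<open>Two-paths inside paths\<close>

context pair_digraph
begin

text \<open>Curried so that paths become \<open>successively arrow\<close>, which splits along
  appends.\<close>

definition arrow :: "'a \<Rightarrow> 'a \<Rightarrow> bool" where
  "arrow x y \<longleftrightarrow> (x, y) \<in> parcs G"

lemma arrow_verts: "arrow x y \<Longrightarrow> x \<in> pverts G" "arrow x y \<Longrightarrow> y \<in> pverts G"
  by (auto simp: arrow_def dest: in_arcsD1 in_arcsD2)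

lemma arrow_irrefl [simp]: "\<not> arrow x x"
  using pair_no_loops by (force simp: arrow_def)

lemma in_npaths_iff:
  "p \<in> npaths G n \<longleftrightarrow> length p = Suc n \<and> set p \<subseteq> pverts G \<and> successively arrow p"
  by (auto simp: npaths_def successively_conv_nth arrow_def)

lemma in_regular_seqs_iff:
  "p \<in> regular_seqs G n \<longleftrightarrow> length p = Suc n \<and> set p \<subseteq> pverts G \<and> successively (\<noteq>) p"
  by (auto simp: regular_seqs_def successively_conv_nth)

lemma npaths_subset_regular_seqs: "npaths G n \<subseteq> regular_seqs G n"
  by (auto simp: in_npaths_iff in_regular_seqs_iff elim!: successively_mono)

lemma two_paths_eq: "two_paths G x y = {[x, v, y] | v. arrow x v \<and> arrow v y}"
proof -
  have "p \<in> two_paths G x y \<longleftrightarrow> (\<exists>v. p = [x, v, y] \<and> arrow x v \<and> arrow v y)" for p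
    by (auto simp: two_paths_def in_npaths_iff length_Suc_conv numeral_2_eq_2 arrow_verts)
  then show ?thesis by blast
qed

lemma finite_two_paths [simp]: "finite (two_paths G x y)"
proof (rule finite_subset)
  show "two_paths G x y \<subseteq> (\<lambda>v. [x, v, y]) ` pverts G"
    by (auto simp: two_paths_eq arrow_verts)
qed (simp add: pair_finite_verts)

lemma dist_two_iff: "dist_two G x y \<longleftrightarrow> x \<noteq> y \<and> \<not> arrow x y \<and> (\<exists>v. arrow x v \<and> arrow v y)"
  by (auto simp: dist_two_def two_paths_eq arrow_def)

text \<open>On the right, \<open>v\<close> occurs only in its two arrows, so it can be exchanged for
  any other middle vertex. The outer pieces are paths themselves, ready to be factors in the path
  algebra.\<close>

lemma npath_two_path_iff:
  "u @ [x, v, y] @ w \<in> npaths G n \<longleftrightarrow>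
     length u + length w + 2 = n \<and> u @ [x] \<in> npaths G (length u) \<and>
     y # w \<in> npaths G (length w) \<and> arrow x v \<and> arrow v y"
  by (auto simp: in_npaths_iff successively_append_iff arrow_verts)

lemma short_moves_iff:
  "(p, q) \<in> short_moves G n \<longleftrightarrow> p \<in> npaths G n \<and> q \<in> npaths G n \<and> p \<noteq> q \<and>
     (\<exists>u x v v' y w. p = u @ [x, v, y] @ w \<and> q = u @ [x, v', y] @ w \<and> dist_two G x y)"
  (is "?L \<longleftrightarrow> ?R")
proof
  assume ?L
  then obtain i where p: "p \<in> npaths G n" and q: "q \<in> npaths G n" and "p \<noteq> q" and i: "0 < i" "i < n"
    and eq: "\<forall>j\<le>n. j \<noteq> i \<longrightarrow> p ! j = q ! j" and d: "dist_two G (p ! (i - 1)) (p ! (i + 1))"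
    by (auto simp: short_moves_def)
  obtain k where k: "i = Suc k" using i by (cases i) auto
  have len: "length p = Suc n" "length q = Suc n" using p q by (auto simp: in_npaths_iff)
  \<comment> \<open>With \<open>i = Suc k\<close>, the moved vertex is the middle of the triple that
    starts at index \<open>k\<close>.\<close>
  have dec: "r = take k r @ [r ! k, r ! Suc k, r ! Suc (Suc k)] @ drop (Suc (Suc (Suc k))) r"
    if "length r = Suc n" for r :: "'a list"
  proof -
    have "drop k r = [r ! k, r ! Suc k, r ! Suc (Suc k)] @ drop (Suc (Suc (Suc k))) r"
      using that i k by (simp add: Cons_nth_drop_Suc)
    then show ?thesis by (metis append_take_drop_id)
  qed
  have "take k p = take k q"
    by (rule nth_take_lemma) (use len eq i k in auto)
  moreover have "drop (Suc (Suc (Suc k))) p = drop (Suc (Suc (Suc k))) q"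
    by (rule nth_equalityI) (use len eq i k in auto)
  moreover have "p ! k = q ! k" "p ! Suc (Suc k) = q ! Suc (Suc k)"
    using eq i k by auto
  ultimately have q_eq: "q = take k p @ [p ! k, q ! Suc k, p ! Suc (Suc k)] @ drop (Suc (Suc (Suc k))) p"
    using dec[OF len(2)] by metis
  have "dist_two G (p ! k) (p ! Suc (Suc k))" using d k by simp
  then show ?R using p q q_eq \<open>p \<noteq> q\<close> dec[OF len(1)] by blast
next
  assume ?R
  then obtain u x v v' y w where *: "p \<in> npaths G n" "q \<in> npaths G n" "p \<noteq> q"
    "p = u @ [x, v, y] @ w" "q = u @ [x, v', y] @ w" "dist_two G x y" by blast
  moreover have "0 < Suc (length u)" "Suc (length u) < n"
    using * by (auto simp: in_npaths_iff)
  moreover have "p ! j = q ! j" if "j \<noteq> Suc (length u)" for j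
    using that by (auto simp: *(4,5) nth_append nth_Cons split: nat.splits)
  moreover have "dist_two G (p ! (Suc (length u) - 1)) (p ! (Suc (length u) + 1))"
    using *(6) by (simp add: *(4) nth_append)
  ultimately show ?L unfolding short_moves_def by blast
qed

lemma thin_path_iff:
  assumes "p \<in> npaths G n"
  shows "thin_path G n p \<longleftrightarrow> (\<exists>u x v y w. p = u @ [x, v, y] @ w \<and> thin_pair G x y)"
proof
  assume "thin_path G n p"
  then obtain i where i: "0 < i" "i < n" "thin_pair G (p ! (i - 1)) (p ! (i + 1))"
    by (auto simp: thin_path_def)
  obtain k where k: "i = Suc k" using i by (cases i) auto
  have "drop k p = [p ! k, p ! Suc k, p ! Suc (Suc k)] @ drop (Suc (Suc (Suc k))) p"
    using assms i k by (simp add: Cons_nth_drop_Suc in_npaths_iff)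
  then have "p = take k p @ [p ! k, p ! Suc k, p ! Suc (Suc k)] @ drop (Suc (Suc (Suc k))) p"
    by (metis append_take_drop_id)
  moreover have "thin_pair G (p ! k) (p ! Suc (Suc k))" using i k by simp
  ultimately show "\<exists>u x v y w. p = u @ [x, v, y] @ w \<and> thin_pair G x y" by blast
next
  assume "\<exists>u x v y w. p = u @ [x, v, y] @ w \<and> thin_pair G x y"
  then obtain u x v y w where p: "p = u @ [x, v, y] @ w" and t: "thin_pair G x y" by blast
  have "Suc (length u) < n" using assms by (simp add: p in_npaths_iff)
  then show "thin_path G n p"
    unfolding thin_path_def using t
    by (intro exI[of _ "Suc (length u)"]) (simp add: p nth_append)
qed

lemma sum_two_paths:
  "(\<Sum>p\<in>two_paths G x y. h p) = (\<Sum>v | arrow x v \<and> arrow v y. h [x, v, y])"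
proof -
  have "two_paths G x y = (\<lambda>v. [x, v, y]) ` {v. arrow x v \<and> arrow v y}"
    by (auto simp: two_paths_eq)
  then show ?thesis by (simp add: sum.reindex inj_on_def)
qed

text \<open>
  Balanced functions are those which, extended linearly to the path algebra, annihilate \<open>T\<close>.
  They detect linear independence in both quotients.
\<close>

definition balanced :: "('a list \<Rightarrow> 'f::field) \<Rightarrow> bool" where
  "balanced e \<longleftrightarrow> (\<forall>u w x y. dist_two G x y \<longrightarrow> (\<Sum>p\<in>two_paths G x y. e (u @ p @ w)) = 0)"

lemma balanced_iff:
  "balanced e \<longleftrightarrow> (\<forall>u w x y. dist_two G x y \<longrightarrow>
     (\<Sum>v | arrow x v \<and> arrow v y. e (u @ [x, v, y] @ w)) = 0)"
  by (simp add: balanced_def sum_two_paths)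

section \<open>Connected components of the short-move graph\<close>

lemma sym_short_moves: "sym (short_moves G n)"
  by (rule symI) (unfold short_moves_iff, blast)

lemma short_moves_npaths: "(p, q) \<in> short_moves G n \<Longrightarrow> p \<in> npaths G n \<and> q \<in> npaths G n"
  by (simp add: short_moves_def)

lemma S_class_subset: "C \<in> S_classes G n \<Longrightarrow> C \<subseteq> npaths G n"
proof -
  have "q \<in> npaths G n" if "(p, q) \<in> (short_moves G n)\<^sup>*" "p \<in> npaths G n" for p q
    using that by (induction rule: rtrancl_induct) (auto dest: short_moves_npaths)
  then show "C \<in> S_classes G n \<Longrightarrow> C \<subseteq> npaths G n"
    by (auto simp: S_classes_def quotient_def)
qed

lemma S_class_connected:
  assumes "C \<in> S_classes G n" "p \<in> C" "q \<in> C"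
  shows "(p, q) \<in> (short_moves G n)\<^sup>*"
proof -
  obtain r where "(r, p) \<in> (short_moves G n)\<^sup>*" "(r, q) \<in> (short_moves G n)\<^sup>*"
    using assms by (auto simp: S_classes_def quotient_def)
  then show ?thesis
    using sym_rtrancl[OF sym_short_moves] by (meson rtrancl_trans symE)
qed

lemma S_class_closed:
  assumes "C \<in> S_classes G n" "p \<in> C" "(p, q) \<in> (short_moves G n)\<^sup>*"
  shows "q \<in> C"
  using assms by (auto simp: S_classes_def quotient_def intro: rtrancl_trans)

lemma S_class_exists: "p \<in> npaths G n \<Longrightarrow> \<exists>C\<in>S_classes G n. p \<in> C"
  by (auto simp: S_classes_def quotient_def)

end

section \<open>Quotients by the two-path relations\<close>

text \<open>\<open>relation\<close> bounds \<open>J\<close> from below, \<open>annihilator\<close>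
  from above. Test functionals vanish off the n-paths because cochain relations also contain
  arbitrary combinations of regular non-paths.\<close>

locale short_move_quotient = pair_digraph G for G :: "'a pair_pre_digraph" +
  fixes n :: nat and J :: "('a list \<Rightarrow>\<^sub>0 'f::field) set"
  assumes no_multisquares: "no_multisquares G"
    and subspace_J: "pm.subspace J"
    and relation: "dist_two G x y \<Longrightarrow> u @ [x, v, y] @ w \<in> npaths G n \<Longrightarrow>
      (\<Sum>p\<in>two_paths G x y. basis_vec (u @ p @ w)) \<in> J"
    and annihilator: "balanced e \<Longrightarrow> (\<And>p. p \<notin> npaths G n \<Longrightarrow> e p = 0) \<Longrightarrow> f \<in> J \<Longrightarrow>
      pairing e f = 0"
begin

text \<open>The absence of multisquares enters here: a pair with one known middle vertex
  \<open>v\<close> is thin or has exactly one further middle vertex.\<close>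

lemma two_paths_cases:
  assumes "dist_two G x y" "arrow x v" "arrow v y"
  obtains "thin_pair G x y" "two_paths G x y = {[x, v, y]}"
  | v' where "v' \<noteq> v" "arrow x v'" "arrow v' y" "\<not> thin_pair G x y"
    "two_paths G x y = {[x, v, y], [x, v', y]}"
proof -
  have v: "[x, v, y] \<in> two_paths G x y" using assms by (auto simp: two_paths_eq)
  have "card (two_paths G x y) \<le> 2"
    using no_multisquares assms(1) by (simp add: no_multisquares_def)
  moreover have "card (two_paths G x y) > 0" using v by (auto simp: card_gt_0_iff)
  ultimately consider "card (two_paths G x y) = 1" | "card (two_paths G x y) = 2" by linarith
  then show ?thesis
  proof cases
    case 1
    then have "two_paths G x y = {[x, v, y]}" using v by (metis card_1_singletonE singletonD)
    with 1 show ?thesis using that(1) assms(1) by (auto simp: thin_pair_def)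
  next
    case 2
    then obtain p q where pq: "two_paths G x y = {p, q}" "p \<noteq> q" by (auto simp: card_2_iff)
    then obtain r where r: "two_paths G x y = {[x, v, y], r}" "r \<noteq> [x, v, y]" using v by auto
    then have "r \<in> two_paths G x y" by simp
    then obtain v' where "r = [x, v', y]" "arrow x v'" "arrow v' y" by (auto simp: two_paths_eq)
    then show ?thesis using that(2)[of v'] r 2 by (auto simp: thin_pair_def)
  qed
qed

lemma thin_path_in:
  assumes p: "p \<in> npaths G n" and "thin_path G n p"
  shows "basis_vec p \<in> J"
proof -
  obtain u x v y w where p_eq: "p = u @ [x, v, y] @ w" and t: "thin_pair G x y"
    using assms thin_path_iff by blast
  have d: "dist_two G x y" using t by (simp add: thin_pair_def)
  have "arrow x v" "arrow v y" using p unfolding p_eq npath_two_path_iff by auto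
  from d this have "two_paths G x y = {[x, v, y]}"
    by (rule two_paths_cases) (use t in auto)
  then show ?thesis using relation[OF d p[unfolded p_eq]] p_eq by simp
qed

text \<open>The relation at the pair around the moved vertex has exactly two summands, as
  \<open>p\<close> and \<open>q\<close> already supply two different middle vertices.\<close>

lemma short_move_in:
  assumes "(p, q) \<in> short_moves G n"
  shows "basis_vec p + basis_vec q \<in> J"
proof -
  obtain u x v v' y w where p: "p = u @ [x, v, y] @ w" and q: "q = u @ [x, v', y] @ w"
    and d: "dist_two G x y" and paths: "p \<in> npaths G n" "q \<in> npaths G n" "p \<noteq> q"
    using assms unfolding short_moves_iff by blast
  have v: "arrow x v" "arrow v y" and v': "arrow x v'" "arrow v' y"
    using paths(1,2) unfolding p q npath_two_path_iff by auto
  have mem: "[x, v', y] \<in> two_paths G x y" using v' by (auto simp: two_paths_eq)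
  have "v' \<noteq> v" using paths(3) p q by auto
  have "two_paths G x y = {[x, v, y], [x, v', y]}"
  proof (rule two_paths_cases[OF d v])
    assume "two_paths G x y = {[x, v, y]}"
    then show ?thesis using mem \<open>v' \<noteq> v\<close> by simp
  next
    fix v'' assume "two_paths G x y = {[x, v, y], [x, v'', y]}"
    then show ?thesis using mem \<open>v' \<noteq> v\<close> by simp
  qed
  then show ?thesis using relation[OF d paths(1)[unfolded p]] \<open>v' \<noteq> v\<close> p q by simp
qed

text \<open>In a fixed context \<open>u\<close>, \<open>w\<close>, the two fillings of a pair are
  joined by a short move, so both lie in \<open>C\<close> or neither does. A filling in
  \<open>C\<close> rules out a thin pair by thickness, and the sum becomes
  \<open>s p + s q\<close>.\<close>

lemma balanced_on_class:
  assumes C: "C \<in> S_classes G n" "thick_class G n C"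
    and s: "\<And>p q. p \<in> C \<Longrightarrow> (p, q) \<in> short_moves G n \<Longrightarrow> s p + s q = (0::'f)"
  shows "balanced (\<lambda>p. if p \<in> C then s p else 0)" (is "balanced ?e")
  unfolding balanced_def
proof (intro allI impI)
  fix u w x y assume d: "dist_two G x y"
  show "(\<Sum>p\<in>two_paths G x y. ?e (u @ p @ w)) = 0"
  proof (cases "\<exists>p\<in>two_paths G x y. u @ p @ w \<in> C")
    case False
    then show ?thesis by (intro sum.neutral) auto
  next
    case True
    then obtain v where v: "arrow x v" "arrow v y" and p: "u @ [x, v, y] @ w \<in> C"
      by (auto simp: two_paths_eq)
    have path: "u @ [x, v, y] @ w \<in> npaths G n" using S_class_subset[OF C(1)] p by blast
    have "\<not> thin_pair G x y"
      using C(2) p thin_path_iff[OF path] unfolding thick_class_def by blast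
    with d v obtain v' where v': "v' \<noteq> v" "arrow x v'" "arrow v' y"
      "two_paths G x y = {[x, v, y], [x, v', y]}"
      by (auto elim: two_paths_cases)
    have "u @ [x, v', y] @ w \<in> npaths G n"
      using path v' unfolding npath_two_path_iff by blast
    then have m: "(u @ [x, v, y] @ w, u @ [x, v', y] @ w) \<in> short_moves G n"
      using path v'(1) d unfolding short_moves_iff by blast
    then have "u @ [x, v', y] @ w \<in> C" using S_class_closed[OF C(1) p] by blast
    then show ?thesis using v' p s[OF p m] by simp
  qed
qed

text \<open>The sign function of the class of \<open>r\<close>, extended by 0, acts as a coordinate
  functional: it kills \<open>J\<close>, and the other members of \<open>S\<close> lie outside that
  class because \<open>P\<close> meets it only once.\<close>

lemma reps_independent:
  assumes P: "complete_reps \<C> P" and \<C>: "\<C> \<subseteq> S_classes G n"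
    and thick: "\<And>C. C \<in> \<C> \<Longrightarrow> thick_class G n C"
    and sign: "\<And>C. C \<in> \<C> \<Longrightarrow> \<exists>s :: 'a list \<Rightarrow> 'f. (\<forall>p\<in>C. s p \<noteq> 0) \<and>
      (\<forall>p q. p \<in> C \<longrightarrow> (p, q) \<in> short_moves G n \<longrightarrow> s p + s q = 0)"
    and S: "finite S" "S \<subseteq> P" "(\<Sum>p\<in>S. scale (c p) (basis_vec p)) \<in> J" "r \<in> S"
  shows "c r = 0"
proof -
  obtain C where C: "C \<in> \<C>" "r \<in> C" using P S unfolding complete_reps_def by blast
  obtain s :: "'a list \<Rightarrow> 'f" where nz: "\<And>p. p \<in> C \<Longrightarrow> s p \<noteq> 0"
    and s: "\<And>p q. p \<in> C \<Longrightarrow> (p, q) \<in> short_moves G n \<Longrightarrow> s p + s q = 0"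
    using sign[OF C(1)] by blast
  let ?e = "\<lambda>p. if p \<in> C then s p else 0"
  have CS: "C \<in> S_classes G n" using C \<C> by blast
  have "balanced ?e" using balanced_on_class[OF CS thick[OF C(1)] s] .
  moreover have "?e p = 0" if "p \<notin> npaths G n" for p
    using that S_class_subset[OF CS] by auto
  ultimately have "pairing ?e (\<Sum>p\<in>S. scale (c p) (basis_vec p)) = 0"
    using annihilator S(3) by blast
  then have "(\<Sum>p\<in>S. c p * ?e p) = 0"
    by (simp add: pairing_sum)
  moreover have "c p * ?e p = 0" if "p \<in> S - {r}" for p
  proof -
    have "p \<notin> C" using that P C S unfolding complete_reps_def by blast
    then show ?thesis by simp
  qed
  then have "(\<Sum>p\<in>S - {r}. c p * ?e p) = 0" by (intro sum.neutral) blast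
  then have "(\<Sum>p\<in>S. c p * ?e p) = c r * ?e r"
    using sum.remove[OF S(1,4), of "\<lambda>p. c p * ?e p"] by simp
  ultimately show ?thesis using nz C by simp
qed

text \<open>Every move flips the sign, so the parity of a walk decides the alternative. Only a
  disjunction is kept, since walks of both parities may join \<open>p\<close> to
  \<open>q\<close>.\<close>

lemma connected_relation:
  assumes "(p, q) \<in> (short_moves G n)\<^sup>*"
  shows "basis_vec q - basis_vec p \<in> J \<or> basis_vec q + basis_vec p \<in> J"
  using assms
proof (induction rule: rtrancl_induct)
  case base
  then show ?case by (simp add: pm.subspace_0[OF subspace_J])
next
  case (step q r)
  have qr: "basis_vec q + basis_vec r \<in> J" using short_move_in[OF step.hyps(2)] .
  from step.IH show ?case
  proof
    assume "basis_vec q - basis_vec p \<in> J"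
    from pm.subspace_diff[OF subspace_J qr this] show ?thesis by (simp add: add.commute)
  next
    assume "basis_vec q + basis_vec p \<in> J"
    from pm.subspace_diff[OF subspace_J qr this] show ?thesis by simp
  qed
qed

text \<open>A thin member of the class is 0 modulo \<open>J\<close>, and a congruence with either
  sign transports this to \<open>p\<close>.\<close>

lemma thin_class_in:
  assumes C: "C \<in> S_classes G n" "\<not> thick_class G n C" and p: "p \<in> C"
  shows "basis_vec p \<in> J"
proof -
  obtain t where t: "t \<in> C" "thin_path G n t" using C(2) by (auto simp: thick_class_def)
  have tJ: "basis_vec t \<in> J" using thin_path_in t S_class_subset[OF C(1)] by blast
  from connected_relation[OF S_class_connected[OF C(1) t(1) p]] show ?thesis
    using pm.subspace_add[OF subspace_J _ tJ] pm.subspace_diff[OF subspace_J _ tJ] by force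
qed

text \<open>
  If no \<open>q\<close> in the class is congruent to both \<open>p\<close> and \<open>-p\<close>, then the congruence
  \<open>q \<equiv> \<plusminus>p\<close> splits the class into a bipartition.
\<close>

lemma nonbipartite_class_in:
  assumes two: "(2::'f) \<noteq> 0"
    and C: "C \<in> S_classes G n" "\<not> bipartite_class G n C" and p: "p \<in> C"
  shows "basis_vec p \<in> J"
proof -
  define A where "A = {q \<in> C. basis_vec q - basis_vec p \<in> J}"
  define B where "B = {q \<in> C. basis_vec q + basis_vec p \<in> J}"
  \<comment> \<open>This is where \<open>2\<close> has to be invertible.\<close>
  have half: "f \<in> J" if "f + f \<in> J" for f :: "'a list \<Rightarrow>\<^sub>0 'f"
  proof -
    have "scale (1 / 2) (f + f) = scale (1 / 2 + 1 / 2) f"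
      by (simp only: pm.scale_left_distrib pm.scale_right_distrib)
    also have "(1 / 2 + 1 / 2 :: 'f) = 1"
      using two by (simp add: field_simps)
    finally have "scale (1 / 2) (f + f) = f" by (simp only: pm.scale_one)
    then show ?thesis using pm.subspace_scale[OF subspace_J that] by metis
  qed
  have AB: "A \<union> B = C"
    using connected_relation[OF S_class_connected[OF C(1) p]] by (auto simp: A_def B_def)
  have both: "basis_vec p \<in> J" if "basis_vec q - basis_vec p \<in> J" "basis_vec q + basis_vec p \<in> J" for q
    using pm.subspace_diff[OF subspace_J that(2,1)] half[of "basis_vec p"] by simp
  show ?thesis
  proof (rule ccontr)
    assume neg: "basis_vec p \<notin> J"
    have "A \<inter> B = {}" using both neg by (auto simp: A_def B_def)
    moreover have "False" if "(q, r) \<in> short_moves G n" "q \<in> A" "r \<in> A" for q r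
    proof -
      \<comment> \<open>Both ends of the move are congruent to \<open>p\<close>, while their sum is
        congruent to 0; the difference of these facts is twice \<open>p\<close>.\<close>
      have "basis_vec q - basis_vec p + (basis_vec r - basis_vec p) \<in> J"
        using that unfolding A_def by (blast intro: pm.subspace_add[OF subspace_J])
      from pm.subspace_diff[OF subspace_J short_move_in[OF that(1)] this]
      have "basis_vec p + basis_vec p \<in> J" by (simp add: algebra_simps)
      with half neg show False by blast
    qed
    moreover have "False" if "(q, r) \<in> short_moves G n" "q \<in> B" "r \<in> B" for q r
    proof -
      have "basis_vec q + basis_vec p + (basis_vec r + basis_vec p) \<in> J"
        using that unfolding B_def by (blast intro: pm.subspace_add[OF subspace_J])
      from pm.subspace_diff[OF subspace_J this short_move_in[OF that(1)]]
      have "basis_vec p + basis_vec p \<in> J" by (simp add: algebra_simps)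
      with half neg show False by blast
    qed
    ultimately have "bipartite_class G n C"
      unfolding bipartite_class_def using AB by (intro exI[of _ A] exI[of _ B]) auto
    with C(2) show False by blast
  qed
qed

lemma reps_span:
  assumes P: "complete_reps \<C> P" and \<C>: "\<C> \<subseteq> S_classes G n"
    and rest: "\<And>C p. C \<in> S_classes G n \<Longrightarrow> C \<notin> \<C> \<Longrightarrow> p \<in> C \<Longrightarrow> basis_vec p \<in> J"
    and f: "Poly_Mapping.keys f \<subseteq> npaths G n"
  shows "\<exists>S c. finite S \<and> S \<subseteq> P \<and> f - (\<Sum>p\<in>S. scale (c p) (basis_vec p)) \<in> J"
proof -
  \<comment> \<open>\<open>T\<close> is the sum of the span of \<open>P\<close> and
    \<open>J\<close>. Being a subspace, it contains \<open>f\<close> once it contains every single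
    n-path, and each of those is 0 or, up to sign, a representative modulo \<open>J\<close>.\<close>
  define T where "T = {a + b | a b. a \<in> {a. Poly_Mapping.keys a \<subseteq> P} \<and> b \<in> J}"
  have T: "pm.subspace T"
    unfolding T_def using pm.subspace_sums[OF subspace_keys subspace_J] .
  have "basis_vec q \<in> T" if q: "q \<in> npaths G n" for q
  proof -
    obtain C where C: "C \<in> S_classes G n" "q \<in> C" using S_class_exists[OF q] by blast
    have inT: "b \<in> T" if "Poly_Mapping.keys a \<subseteq> P" "b - a \<in> J" for a b
      unfolding T_def mem_Collect_eq using that by (intro exI[of _ a] exI[of _ "b - a"]) simp
    show ?thesis
    proof (cases "C \<in> \<C>")
      case False
      then show ?thesis using rest[OF C(1) False C(2)] by (intro inT[of 0]) auto
    next
      case True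
      then obtain p where p: "p \<in> P" "p \<in> C" using P unfolding complete_reps_def by blast
      from connected_relation[OF S_class_connected[OF C(1) p(2) C(2)]] show ?thesis
        using p by (auto intro: inT[of "basis_vec p"] inT[of "- basis_vec p"])
    qed
  qed
  then have "f \<in> T" using subspace_supportI[OF T] f by blast
  then obtain a b where a: "Poly_Mapping.keys a \<subseteq> P" and b: "b \<in> J" and fab: "f = a + b"
    by (auto simp: T_def)
  have "(\<Sum>p\<in>Poly_Mapping.keys a. scale (Poly_Mapping.lookup a p) (basis_vec p)) = a"
    by (subst (3) poly_mapping_sum_singles) simp
  then have "f - (\<Sum>p\<in>Poly_Mapping.keys a. scale (Poly_Mapping.lookup a p) (basis_vec p)) \<in> J"
    using b fab by simp
  then show ?thesis using a finite_keys by blast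
qed

text \<open>The two characteristics differ only in the family of classes, in the choice of sign
  function and in why the other classes vanish. The last condition on \<open>U\<close> admits spaces
  larger than the span of the n-paths, such as all regular cochains.\<close>

lemma is_basis_reps:
  fixes M :: "('f, 'a list \<Rightarrow>\<^sub>0 'f) module" and Q :: "('f, ('a list \<Rightarrow>\<^sub>0 'f) set) module"
  assumes P: "CHAR('f) = 2 \<and> complete_reps {C \<in> S_classes G n. thick_class G n C} P \<or>
      CHAR('f) \<noteq> 2 \<and>
        complete_reps {C \<in> S_classes G n. thick_class G n C \<and> bipartite_class G n C} P"
    and M: "add M = (+)" "smult M = scale"
    and Q: "carrier Q = (\<lambda>f. J +>\<^bsub>M\<^esub> f) ` U" "add Q = set_add M" "zero Q = J"
      "smult Q = (\<lambda>c X. \<Union>x\<in>X. J +>\<^bsub>M\<^esub> (c \<odot>\<^bsub>M\<^esub> x))"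
    and U: "pm.subspace U" "\<And>p. p \<in> npaths G n \<Longrightarrow> basis_vec p \<in> U"
      "\<And>f. f \<in> U \<Longrightarrow> \<exists>g. Poly_Mapping.keys g \<subseteq> npaths G n \<and> f - g \<in> J"
  shows "is_basis Q P (\<lambda>p. J +>\<^bsub>M\<^esub> basis_vec p)"
proof -
  define \<C> where "\<C> = (if CHAR('f) = 2 then {C \<in> S_classes G n. thick_class G n C}
    else {C \<in> S_classes G n. thick_class G n C \<and> bipartite_class G n C})"
  have reps: "complete_reps \<C> P" using P by (auto simp: \<C>_def)
  have \<C>: "\<C> \<subseteq> S_classes G n" and thick: "\<And>C. C \<in> \<C> \<Longrightarrow> thick_class G n C"
    by (auto simp: \<C>_def split: if_splits)
  have P_sub: "P \<subseteq> npaths G n"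
    using reps \<C> S_class_subset unfolding complete_reps_def by blast
  \<comment> \<open>A characteristic dividing 2 is 1 or 2, and 1 is excluded because
    \<open>1\<close> is nonzero in a field.\<close>
  have two: "CHAR('f) = 2 \<longleftrightarrow> (2::'f) = 0"
  proof -
    have "(2::'f) = 0 \<longleftrightarrow> CHAR('f) dvd 2" using of_nat_eq_0_iff_char_dvd[of 2, where ?'a='f] by simp
    also have "\<dots> \<longleftrightarrow> CHAR('f) = 2"
    proof
      assume "CHAR('f) dvd 2"
      then have "CHAR('f) \<le> 2" "CHAR('f) \<noteq> 0"
        using dvd_imp_le[of _ 2] by (simp, metis dvd_0_left_iff zero_neq_numeral)
      moreover have "CHAR('f) \<noteq> 1" by simp
      ultimately show "CHAR('f) = 2" by linarith
    qed simp
    finally show ?thesis by simp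
  qed
  have sign: "\<exists>s :: 'a list \<Rightarrow> 'f. (\<forall>p\<in>C. s p \<noteq> 0) \<and>
      (\<forall>p q. p \<in> C \<longrightarrow> (p, q) \<in> short_moves G n \<longrightarrow> s p + s q = 0)" if C: "C \<in> \<C>" for C
  proof (cases "CHAR('f) = 2")
    case True
    then show ?thesis using two by (intro exI[of _ "\<lambda>_. 1"]) auto
  next
    case False
    then obtain A B where AB: "A \<union> B = C" "A \<inter> B = {}" "short_moves G n \<inter> A \<times> A = {}"
      "short_moves G n \<inter> B \<times> B = {}"
      using C by (auto simp: \<C>_def bipartite_class_def)
    have "(if p \<in> A then 1 else - 1) + (if q \<in> A then 1 else - 1) = (0::'f)"
      if "p \<in> C" "(p, q) \<in> short_moves G n" for p q
    proof -
      have "q \<in> C" using S_class_closed that \<C> C by blast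
      then have "p \<in> A \<longleftrightarrow> q \<notin> A" using that AB by blast
      then show ?thesis by auto
    qed
    then show ?thesis by (intro exI[of _ "\<lambda>p. if p \<in> A then 1 else - 1"]) auto
  qed
  have rest: "basis_vec p \<in> J" if "C \<in> S_classes G n" "C \<notin> \<C>" "p \<in> C" for C p
    using that thin_class_in nonbipartite_class_in two by (auto simp: \<C>_def split: if_splits)
  show ?thesis
  proof (rule is_basis_quotI[OF M Q subspace_J U(1)])
    show "basis_vec \<in> P \<rightarrow> U" using P_sub U(2) by blast
    show "c p = 0"
      if "finite S" "S \<subseteq> P" "(\<Sum>p\<in>S. scale (c p) (basis_vec p)) \<in> J" "p \<in> S" for S c p
      using reps_independent[OF reps \<C> thick sign that] .
    show "\<exists>S c. finite S \<and> S \<subseteq> P \<and> f - (\<Sum>p\<in>S. scale (c p) (basis_vec p)) \<in> J"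
      if f: "f \<in> U" for f
    proof -
      obtain g where g: "Poly_Mapping.keys g \<subseteq> npaths G n" "f - g \<in> J" using U(3)[OF f] by (elim exE conjE)
      have "\<exists>S c. finite S \<and> S \<subseteq> P \<and> g - (\<Sum>p\<in>S. scale (c p) (basis_vec p)) \<in> J"
        using rest by (rule reps_span[OF reps \<C> _ g(1)])
      then obtain S c where S: "finite S" "S \<subseteq> P" "g - (\<Sum>p\<in>S. scale (c p) (basis_vec p)) \<in> J"
        by (elim exE conjE)
      have "f - (\<Sum>p\<in>S. scale (c p) (basis_vec p)) \<in> J"
        using pm.subspace_add[OF subspace_J g(2) S(3)] by simp
      with S show ?thesis by (intro exI conjI)
    qed
  qed
qed

end

section \<open>The ideal of the path algebra\<close>

text \<open>Applied to one argument after the other, this reduces multilinear identities to single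
  paths, with the support condition at hand for those.\<close>

lemma poly_mapping_support_induct [consumes 1, case_names zero add single]:
  fixes f :: "'b \<Rightarrow>\<^sub>0 'c::comm_monoid_add"
  assumes "Poly_Mapping.keys f \<subseteq> B"
    and "P 0" "\<And>f g. P f \<Longrightarrow> P g \<Longrightarrow> P (f + g)"
    and "\<And>k a. k \<in> B \<Longrightarrow> P (Poly_Mapping.single k a)"
  shows "P f"
proof -
  have "P (\<Sum>k\<in>S. Poly_Mapping.single k (c k))" if "finite S" "S \<subseteq> B" for S c
    using that by (induction S rule: finite_induct) (auto intro: assms)
  from this[OF finite_keys assms(1)] show ?thesis
    by (subst poly_mapping_sum_singles)
qed

section \<open>The concatenation product and its transposes\<close>

lemma path_mult_zero [simp]: "path_mult 0 g = 0" "path_mult f 0 = 0"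
  by (simp_all add: path_mult_def)

lemma path_mult_add_left: "path_mult (f + f') g = path_mult f g + path_mult f' g"
  unfolding path_mult_def
proof (rule setsum_keys_plus_distrib, goal_cases)
  case (1 p)
  show ?case by (rule sum.neutral) simp
next
  case (2 p)
  show ?case by (auto simp: single_add distrib_right simp flip: sum.distrib intro!: sum.cong)
qed

lemma path_mult_add_right: "path_mult f (g + g') = path_mult f g + path_mult f g'"
  unfolding path_mult_def sum.distrib[symmetric]
  by (intro sum.cong refl setsum_keys_plus_distrib) (auto simp: single_add distrib_left)

lemma path_mult_sum_left: "path_mult (sum h S) g = (\<Sum>i\<in>S. path_mult (h i) g)"
  by (rule additive_sum[where F = "\<lambda>f. path_mult f g"]) (rule path_mult_add_left)

lemma path_mult_sum_right: "path_mult f (sum h S) = (\<Sum>i\<in>S. path_mult f (h i))"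
  by (rule additive_sum) (rule path_mult_add_right)

lemma path_mult_single:
  "path_mult (Poly_Mapping.single p a) (Poly_Mapping.single q b) =
     (if last p = hd q then Poly_Mapping.single (p @ tl q) (a * b) else 0)"
  by (simp add: path_mult_def)

lemma last_append_tl: "p \<noteq> [] \<Longrightarrow> q \<noteq> [] \<Longrightarrow> last p = hd q \<Longrightarrow> last (p @ tl q) = last q"
  by (cases q) auto

text \<open>For nonempty matching lists a product begins where its left factor begins and ends where
  its right factor ends, so both bracketings test the same two matchings. The empty list is no path
  and is kept out of the supports.\<close>

lemma path_mult_assoc:
  assumes "Poly_Mapping.keys f \<subseteq> - {[]}" "Poly_Mapping.keys g \<subseteq> - {[]}" "Poly_Mapping.keys h \<subseteq> - {[]}"
  shows "path_mult (path_mult f g) h = path_mult f (path_mult g h)"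
  using assms(1)
proof (induction rule: poly_mapping_support_induct)
  case (single p a)
  from assms(2) show ?case
  proof (induction rule: poly_mapping_support_induct)
    case (single q b)
    from assms(3) show ?case
    proof (induction rule: poly_mapping_support_induct)
      case (single r c)
      then show ?case
        using \<open>p \<in> - {[]}\<close> \<open>q \<in> - {[]}\<close>
        by (simp add: path_mult_single last_append_tl mult.assoc)
    qed (simp_all add: path_mult_add_right)
  qed (simp_all add: path_mult_add_right path_mult_add_left)
qed (simp_all add: path_mult_add_left)

text \<open>The transpose of left multiplication by a path: the product moves from the vector to the
  functional.\<close>

lemma pairing_path_mult_single_left:
  "pairing e (path_mult (Poly_Mapping.single p a) f) =
     a * pairing (\<lambda>q. if last p = hd q then e (p @ tl q) else 0) f"
proof -
  have "Poly_Mapping.keys f \<subseteq> UNIV" by simp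
  then show ?thesis
    by (induction rule: poly_mapping_support_induct)
       (auto simp: path_mult_single path_mult_add_right pairing_add distrib_left)
qed

lemma pairing_path_mult_single_right:
  "pairing e (path_mult f (Poly_Mapping.single p a)) =
     a * pairing (\<lambda>q. if last q = hd p then e (q @ tl p) else 0) f"
proof -
  have "Poly_Mapping.keys f \<subseteq> UNIV" by simp
  then show ?thesis
    by (induction rule: poly_mapping_support_induct)
       (auto simp: path_mult_single path_mult_add_left pairing_add distrib_left)
qed

lemma path_algebra_simps:
  "carrier (path_algebra G) = {f. Poly_Mapping.keys f \<subseteq> (\<Union>n. npaths G n)}"
  "mult (path_algebra G) = path_mult"
  "one (path_algebra G) = (\<Sum>v\<in>pverts G. basis_vec [v])"
  "zero (path_algebra G) = 0"
  "add (path_algebra G) = (+)"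
  "smult (path_algebra G) = scale"
  by (simp_all add: path_algebra_def free_space_def)

section \<open>The path algebra as a ring\<close>

context pair_digraph
begin

abbreviation all_paths :: "'a list set" where
  "all_paths \<equiv> \<Union>n. npaths G n"

lemma in_all_paths_iff:
  "p \<in> all_paths \<longleftrightarrow> p \<noteq> [] \<and> set p \<subseteq> pverts G \<and> successively arrow p"
  by (cases p) (auto simp: in_npaths_iff)

lemma append_tl_in_all_paths:
  "p \<in> all_paths \<Longrightarrow> q \<in> all_paths \<Longrightarrow> last p = hd q \<Longrightarrow> p @ tl q \<in> all_paths"
  unfolding in_all_paths_iff
  by (cases q) (auto simp: successively_append_iff successively_Cons)

lemma path_mult_closed:
  assumes "f \<in> carrier (path_algebra G)" "g \<in> carrier (path_algebra G)"
  shows "path_mult f g \<in> carrier (path_algebra G)"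
proof -
  let ?C = "carrier (path_algebra G) :: ('a list \<Rightarrow>\<^sub>0 'b) set"
  have add: "f + g \<in> ?C" if "f \<in> ?C" "g \<in> ?C" for f g
    using that keys_add[of f g] by (auto simp: path_algebra_simps)
  have zero: "0 \<in> ?C" by (simp add: path_algebra_simps)
  have "Poly_Mapping.keys f \<subseteq> all_paths" using assms(1) by (simp add: path_algebra_simps)
  then show ?thesis
  proof (induction rule: poly_mapping_support_induct)
    case (single p a)
    have "Poly_Mapping.keys g \<subseteq> all_paths" using assms(2) by (simp add: path_algebra_simps)
    then show ?case
    proof (induction rule: poly_mapping_support_induct)
      case (single q b)
      then show ?case
        using append_tl_in_all_paths[OF \<open>p \<in> all_paths\<close>]
        by (simp add: path_mult_single path_algebra_simps)
    qed (use add zero in \<open>simp_all add: path_mult_add_right\<close>)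
  qed (use add zero in \<open>simp_all add: path_mult_add_left\<close>)
qed

lemma carrier_keys_nonempty:
  "f \<in> carrier (path_algebra G) \<Longrightarrow> Poly_Mapping.keys f \<subseteq> - {[]}"
  using in_all_paths_iff by (auto simp: path_algebra_simps)

text \<open>The case \<open>c = 1\<close> gives the unit laws. General \<open>c\<close> exhibits
  scaling as multiplication by a ring element, which makes ideals closed under scalars.\<close>

lemma path_mult_units:
  assumes "f \<in> carrier (path_algebra G)"
  shows "path_mult (\<Sum>v\<in>pverts G. Poly_Mapping.single [v] c) f = scale c f"
    and "path_mult f (\<Sum>v\<in>pverts G. Poly_Mapping.single [v] c) = scale c f"
proof -
  have f: "Poly_Mapping.keys f \<subseteq> all_paths" using assms by (simp add: path_algebra_simps)
  from f show "path_mult (\<Sum>v\<in>pverts G. Poly_Mapping.single [v] c) f = scale c f"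
  proof (induction rule: poly_mapping_support_induct)
    case (single p a)
    then have "p \<noteq> []" "hd p \<in> pverts G" unfolding in_all_paths_iff by auto
    then show ?case
      using pair_finite_verts by (simp add: path_mult_sum_left path_mult_single)
  qed (simp_all add: path_mult_add_right pm.scale_right_distrib)
  from f show "path_mult f (\<Sum>v\<in>pverts G. Poly_Mapping.single [v] c) = scale c f"
  proof (induction rule: poly_mapping_support_induct)
    case (single p a)
    then have "p \<noteq> []" "last p \<in> pverts G" unfolding in_all_paths_iff by auto
    then show ?case
      using pair_finite_verts by (simp add: path_mult_sum_right path_mult_single mult.commute)
  qed (simp_all add: path_mult_add_left pm.scale_right_distrib)
qed

lemma sum_verts_in_carrier:
  "(\<Sum>v\<in>pverts G. Poly_Mapping.single [v] c) \<in> carrier (path_algebra G)"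
  unfolding path_algebra_simps
  by (intro pm.subspace_sum subspace_keys) (auto simp: in_npaths_iff intro: exI[of _ 0])

lemma ring_path_algebra: "ring (path_algebra G :: ('f::field, 'a list \<Rightarrow>\<^sub>0 'f) module)"
proof (rule ringI)
  let ?R = "path_algebra G :: ('f, 'a list \<Rightarrow>\<^sub>0 'f) module"
  have neg: "- f \<in> carrier ?R" if "f \<in> carrier ?R" for f
    using pm.subspace_neg[OF subspace_keys] that by (simp add: path_algebra_simps)
  have add: "f + g \<in> carrier ?R" if "f \<in> carrier ?R" "g \<in> carrier ?R" for f g
    using pm.subspace_add[OF subspace_keys] that by (simp add: path_algebra_simps)
  have zero: "0 \<in> carrier ?R" by (simp add: path_algebra_simps)
  show "abelian_group ?R"
    by (rule abelian_groupI)
       (use add zero neg in \<open>auto simp: path_algebra_simps(4,5) ac_simps intro: bexI[of _ "- _"]\<close>)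
  have assoc: "path_mult (path_mult f g) h = path_mult f (path_mult g h)"
    if "f \<in> carrier ?R" "g \<in> carrier ?R" "h \<in> carrier ?R" for f g h
    by (intro path_mult_assoc carrier_keys_nonempty that)
  show "Group.monoid ?R"
    using path_mult_closed assoc sum_verts_in_carrier[of 1] path_mult_units[of _ 1]
    by (intro monoidI) (simp_all add: path_algebra_simps(2,3))
qed (simp_all add: path_algebra_simps(2,5) path_mult_add_left path_mult_add_right)

text \<open>Balance is demanded for arbitrary lists \<open>u\<close> and \<open>w\<close>, so a
  prefix \<open>p\<close> is absorbed into \<open>u\<close>.\<close>

lemma balanced_pullback_left:
  assumes e: "balanced e" and p: "p \<noteq> []"
  shows "balanced (\<lambda>q. if last p = hd q then e (p @ tl q) else 0)"
  unfolding balanced_iff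
proof (intro allI impI)
  fix u w x y assume d: "dist_two G x y"
  have *: "(\<Sum>v | arrow x v \<and> arrow v y. e (u' @ [x, v, y] @ w)) = 0" for u'
    using e d unfolding balanced_iff by blast
  show "(\<Sum>v | arrow x v \<and> arrow v y.
    if last p = hd (u @ [x, v, y] @ w) then e (p @ tl (u @ [x, v, y] @ w)) else 0) = 0"
  proof (cases u)
    case Nil
    show ?thesis
    proof (cases "last p = x")
      case True
      \<comment> \<open>With empty \<open>u\<close> the product glues \<open>p\<close> at
        \<open>x\<close> itself, so the new context is \<open>p\<close> without its last
        vertex.\<close>
      then obtain p' where "p = p' @ [x]" using p by (metis append_butlast_last_id)
      then show ?thesis using *[of p'] Nil by simp
    qed (simp add: Nil)
  next
    case (Cons z u')
    then show ?thesis using *[of "p @ u'"] by (cases "last p = z") simp_all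
  qed
qed

lemma balanced_pullback_right:
  assumes e: "balanced e"
  shows "balanced (\<lambda>q. if last q = hd p then e (q @ tl p) else 0)"
  unfolding balanced_iff
proof (intro allI impI)
  fix u w x y assume d: "dist_two G x y"
  have "(\<Sum>v | arrow x v \<and> arrow v y. e (u @ [x, v, y] @ (w @ tl p))) = 0"
    using e d unfolding balanced_iff by blast
  \<comment> \<open>The matching condition does not depend on the summation variable
    \<open>v\<close>, because the triple ends in \<open>y\<close>.\<close>
  moreover have "last (u @ [x, v, y] @ w) = last (y # w)" for v by simp
  ultimately show "(\<Sum>v | arrow x v \<and> arrow v y.
    if last (u @ [x, v, y] @ w) = hd p then e ((u @ [x, v, y] @ w) @ tl p) else 0) = 0"
    by (cases "last (y # w) = hd p") simp_all
qed

text \<open>An upper bound for \<open>T_ideal G\<close> that avoids describing its elements. Closure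
  under products holds because multiplying by a path amounts to pulling back the functional, which
  stays balanced.\<close>

lemma ideal_annihilated:
  "ideal {f \<in> carrier (path_algebra G). \<forall>e. balanced e \<longrightarrow> pairing e f = 0}
     (path_algebra G :: ('f::field, 'a list \<Rightarrow>\<^sub>0 'f) module)"
  (is "ideal ?I ?R")
proof (rule idealI[OF ring_path_algebra])
  interpret R: ring ?R by (rule ring_path_algebra)
  \<comment> \<open>Negation in the ring is defined through inverses in the carrier and has to be
    identified with that of finitely supported functions.\<close>
  have uminus: "\<ominus>\<^bsub>?R\<^esub> f = - f" if "f \<in> carrier ?R" for f
    by (rule R.minus_equality)
       (use that pm.subspace_neg[OF subspace_keys] in \<open>auto simp: path_algebra_simps\<close>)
  show "subgroup ?I (add_monoid ?R)"
  proof (rule R.add.subgroupI)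
    show "?I \<noteq> {}" using R.zero_closed by (auto simp: path_algebra_simps(4))
  next
    fix f assume f: "f \<in> ?I"
    have "pairing e (- f) = - pairing e f" for e
      using pairing_scale[of e "- 1" f] by simp
    then show "\<ominus>\<^bsub>?R\<^esub> f \<in> ?I" using f R.a_inv_closed uminus by fastforce
  next
    fix f g assume "f \<in> ?I" "g \<in> ?I"
    then show "f \<oplus>\<^bsub>?R\<^esub> g \<in> ?I"
      using R.add.m_closed[of f g] by (auto simp: path_algebra_simps(5) pairing_add)
  qed auto
  fix f g assume f: "f \<in> ?I" and g: "g \<in> carrier ?R"
  have fc: "f \<in> carrier ?R" using f by simp
  have g': "Poly_Mapping.keys g \<subseteq> all_paths" using g by (simp add: path_algebra_simps)
  have "pairing e (path_mult g f) = 0 \<and> pairing e (path_mult f g) = 0" if e: "balanced e" for e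
    using g'
  proof (induction rule: poly_mapping_support_induct)
    case (single p a)
    have "p \<noteq> []" using single in_all_paths_iff by blast
    then show ?case
      using f balanced_pullback_left[OF e] balanced_pullback_right[OF e]
      by (simp add: pairing_path_mult_single_left pairing_path_mult_single_right)
  qed (simp_all add: path_mult_add_left path_mult_add_right pairing_add)
  then show "g \<otimes>\<^bsub>?R\<^esub> f \<in> ?I" "f \<otimes>\<^bsub>?R\<^esub> g \<in> ?I"
    using path_mult_closed[OF g fc] path_mult_closed[OF fc g] by (simp_all add: path_algebra_simps(2))
qed

lemma T_gen_in_carrier: "T_gen G x y \<in> carrier (path_algebra G)"
  unfolding path_algebra_simps T_gen_def
  by (intro pm.subspace_sum subspace_keys) (auto simp: two_paths_def)

lemma ideal_T_ideal: "ideal (T_ideal G) (path_algebra G :: ('f::field, 'a list \<Rightarrow>\<^sub>0 'f) module)"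
  unfolding T_ideal_def
  by (rule ring.genideal_ideal[OF ring_path_algebra]) (use T_gen_in_carrier in auto)

lemma T_gen_in_T_ideal: "dist_two G x y \<Longrightarrow> T_gen G x y \<in> (T_ideal G :: ('a list \<Rightarrow>\<^sub>0 'f::field) set)"
proof -
  have "{T_gen G x y | x y. dist_two G x y} \<subseteq> (T_ideal G :: ('a list \<Rightarrow>\<^sub>0 'f) set)"
    unfolding T_ideal_def
    by (rule ring.genideal_self[OF ring_path_algebra]) (use T_gen_in_carrier in auto)
  then show "dist_two G x y \<Longrightarrow> T_gen G x y \<in> (T_ideal G :: ('a list \<Rightarrow>\<^sub>0 'f) set)" by blast
qed

lemma T_ideal_annihilated:
  fixes e :: "'a list \<Rightarrow> 'f::field"
  assumes "f \<in> T_ideal G" "balanced e"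
  shows "pairing e f = 0"
proof -
  have "pairing e (T_gen G x y) = 0" if "balanced e" "dist_two G x y" for e :: "'a list \<Rightarrow> 'f" and x y
  proof -
    \<comment> \<open>A generator is the relation with empty context.\<close>
    have "(\<Sum>p\<in>two_paths G x y. e ([] @ p @ [])) = 0"
      using that unfolding balanced_def by blast
    then show ?thesis by (simp add: T_gen_def pairing_sum)
  qed
  then have "T_ideal G \<subseteq> {f :: 'a list \<Rightarrow>\<^sub>0 'f. f \<in> carrier (path_algebra G) \<and> (\<forall>e. balanced e \<longrightarrow> pairing e f = 0)}"
    unfolding T_ideal_def
    by (intro ring.genideal_minimal[OF ring_path_algebra ideal_annihilated])
       (use T_gen_in_carrier in auto)
  then show ?thesis using assms by blast
qed

text \<open>Multiplying the generator at \<open>(x, y)\<close> by \<open>u @ [x]\<close> on the left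
  and \<open>y # w\<close> on the right puts it into context.\<close>

lemma T_ideal_relation:
  assumes d: "dist_two G x y" and path: "u @ [x, v, y] @ w \<in> npaths G n"
  shows "(\<Sum>p\<in>two_paths G x y. basis_vec (u @ p @ w)) \<in> (T_ideal G :: ('a list \<Rightarrow>\<^sub>0 'f::field) set)"
proof -
  interpret I: ideal "T_ideal G" "path_algebra G :: ('f, 'a list \<Rightarrow>\<^sub>0 'f) module"
    by (rule ideal_T_ideal)
  have "u @ [x] \<in> all_paths" "y # w \<in> all_paths"
    using path unfolding npath_two_path_iff by blast+
  then have "basis_vec (u @ [x]) \<in> carrier (path_algebra G :: ('f, 'a list \<Rightarrow>\<^sub>0 'f) module)"
    "basis_vec (y # w) \<in> carrier (path_algebra G :: ('f, 'a list \<Rightarrow>\<^sub>0 'f) module)"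
    by (simp_all add: path_algebra_simps)
  then have "path_mult (path_mult (basis_vec (u @ [x])) (T_gen G x y)) (basis_vec (y # w)) \<in> (T_ideal G :: ('a list \<Rightarrow>\<^sub>0 'f) set)"
    using I.I_l_closed[OF T_gen_in_T_ideal[OF d]] I.I_r_closed by (simp add: path_algebra_simps(2))
  moreover have "path_mult (path_mult (basis_vec (u @ [x])) (T_gen G x y)) (basis_vec (y # w)) =
      (\<Sum>p\<in>two_paths G x y. basis_vec (u @ p @ w) :: 'a list \<Rightarrow>\<^sub>0 'f)"
    by (simp add: T_gen_def sum_two_paths path_mult_sum_left path_mult_sum_right path_mult_single)
  ultimately show ?thesis by simp
qed

lemma subspace_T_ideal: "pm.subspace (T_ideal G :: ('a list \<Rightarrow>\<^sub>0 'f::field) set)"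
proof -
  interpret I: ideal "T_ideal G" "path_algebra G :: ('f, 'a list \<Rightarrow>\<^sub>0 'f) module"
    by (rule ideal_T_ideal)
  show ?thesis
    unfolding pm.subspace_def
  proof (intro conjI ballI allI)
    show "0 \<in> (T_ideal G :: ('a list \<Rightarrow>\<^sub>0 'f) set)"
      using additive_subgroup.zero_closed[OF I.is_additive_subgroup] by (simp add: path_algebra_simps(4))
    show "f + g \<in> T_ideal G" if "f \<in> T_ideal G" "g \<in> T_ideal G" for f g :: "'a list \<Rightarrow>\<^sub>0 'f"
      using additive_subgroup.a_closed[OF I.is_additive_subgroup that] by (simp add: path_algebra_simps(5))
    show "scale c f \<in> T_ideal G" if "f \<in> T_ideal G" for c and f :: "'a list \<Rightarrow>\<^sub>0 'f"
      using I.I_l_closed[OF that sum_verts_in_carrier[of c]] path_mult_units(1)[of f c] I.Icarr[OF that]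
      by (simp add: path_algebra_simps(2))
  qed
qed

lemma path_quotient_basis:
  assumes "no_multisquares G"
    and P: "CHAR('f) = 2 \<and> complete_reps {C \<in> S_classes G n. thick_class G n C} P \<or>
      CHAR('f) \<noteq> 2 \<and>
        complete_reps {C \<in> S_classes G n. thick_class G n C \<and> bipartite_class G n C} P"
  shows "is_basis (path_quotient G n :: ('f::field, ('a list \<Rightarrow>\<^sub>0 'f) set) module) P
    (\<lambda>p. T_class G (basis_vec p))"
proof -
  interpret short_move_quotient G n "T_ideal G :: ('a list \<Rightarrow>\<^sub>0 'f) set"
    using assms(1) subspace_T_ideal T_ideal_relation T_ideal_annihilated
    by unfold_locales auto
  show ?thesis
    unfolding T_class_def
  proof (rule is_basis_reps[OF P])
    let ?Q = "path_quotient G n :: ('f, ('a list \<Rightarrow>\<^sub>0 'f) set) module"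
    let ?R = "path_algebra G :: ('f, 'a list \<Rightarrow>\<^sub>0 'f) module"
    show "carrier ?Q = (+>\<^bsub>?R\<^esub>) (T_ideal G) ` {f. Poly_Mapping.keys f \<subseteq> npaths G n}"
      by (simp add: path_quotient_def T_class_def)
    show "\<exists>g. Poly_Mapping.keys g \<subseteq> npaths G n \<and> f - g \<in> T_ideal G"
      if "f \<in> {f. Poly_Mapping.keys f \<subseteq> npaths G n}" for f :: "'a list \<Rightarrow>\<^sub>0 'f"
      using that by (intro exI[of _ f]) (auto simp: pm.subspace_0[OF subspace_J])
  qed (simp_all add: path_algebra_simps path_quotient_def quot_space_def ring.defs FactRing_def subspace_keys)
qed

end

section \<open>The coboundary relations\<close>

lemma coboundary_zero [simp]: "coboundary G 0 = 0"
  by (simp add: coboundary_def)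

lemma coboundary_add: "coboundary G (f + g) = coboundary G f + coboundary G g"
  unfolding coboundary_def
  by (rule setsum_keys_plus_distrib) (simp_all add: single_add distrib_left sum.distrib)

lemma coboundary_single:
  "coboundary G (Poly_Mapping.single x c) = (\<Sum>(i, v)\<in>{..length x} \<times> pverts G.
     Poly_Mapping.single (take i x @ v # drop i x) ((- 1) ^ i * c))"
  by (simp add: coboundary_def sum.cartesian_product)

lemma coboundary_scale: "coboundary G (scale c f) = scale c (coboundary G f)"
proof -
  have "Poly_Mapping.keys f \<subseteq> UNIV" by simp
  then show ?thesis
    by (induction rule: poly_mapping_support_induct)
       (simp_all add: coboundary_single coboundary_add pm.scale_right_distrib pm.scale_sum_right
         case_prod_unfold mult.left_commute)
qed

lemma subspace_N_space: "pm.subspace (N_space G n)"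
  unfolding N_space_def by (rule subspace_keys)

lemma subspace_J_space: "pm.subspace (J_space G n :: ('a list \<Rightarrow>\<^sub>0 'f::field) set)"
proof (cases n)
  case 0
  then show ?thesis by (simp add: subspace_N_space)
next
  case (Suc m)
  note N = subspace_N_space[of G m] and N' = subspace_N_space[of G "Suc m"]
  have "pm.subspace (coboundary G ` N_space G m :: ('a list \<Rightarrow>\<^sub>0 'f) set)"
    unfolding pm.subspace_def
  proof (intro conjI ballI allI)
    show "0 \<in> (coboundary G ` N_space G m :: ('a list \<Rightarrow>\<^sub>0 'f) set)"
      using pm.subspace_0[OF N] coboundary_zero by (metis imageI)
  next
    fix f g :: "'a list \<Rightarrow>\<^sub>0 'f"
    assume "f \<in> coboundary G ` N_space G m" "g \<in> coboundary G ` N_space G m"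
    then show "f + g \<in> coboundary G ` N_space G m"
      using pm.subspace_add[OF N] by (auto simp flip: coboundary_add intro!: imageI)
  next
    fix c and f :: "'a list \<Rightarrow>\<^sub>0 'f"
    assume "f \<in> coboundary G ` N_space G m"
    then show "scale c f \<in> coboundary G ` N_space G m"
      using pm.subspace_scale[OF N] by (auto simp flip: coboundary_scale intro!: imageI)
  qed
  note pm.subspace_sums[OF N' this]
  moreover have "(J_space G n :: ('a list \<Rightarrow>\<^sub>0 'f) set) =
      {f + h | f h. f \<in> N_space G (Suc m) \<and> h \<in> coboundary G ` N_space G m}"
    unfolding Suc by auto
  ultimately show ?thesis by simp
qed

lemma N_space_subset_J_space: "N_space G n \<subseteq> J_space G n"
proof (cases n)
  case (Suc m)
  have "f = f + coboundary G 0" for f :: "'a list \<Rightarrow>\<^sub>0 'b::field" by simp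
  then show ?thesis
    using pm.subspace_0[OF subspace_N_space[of G m]] unfolding Suc J_space.simps by blast
qed simp

lemma not_successivelyE:
  assumes "\<not> successively P x"
  obtains a s t b where "x = a @ [s, t] @ b" "\<not> P s t"
proof -
  have "\<exists>a s t b. x = a @ [s, t] @ b \<and> \<not> P s t"
    using assms
  proof (induction x)
    case (Cons z x)
    show ?case
    proof (cases "successively P x")
      case True
      with Cons.prems obtain t b where "x = t # b" "\<not> P z t"
        by (cases x) (auto simp: successively_Cons)
      then show ?thesis by (intro exI[of _ "[]"]) auto
    next
      case False
      from Cons.IH[OF this] obtain a s t b where "x = a @ [s, t] @ b" "\<not> P s t" by blast
      then show ?thesis by (intro exI[of _ "z # a"]) auto
    qed
  qed simp
  then show thesis using that by blast
qed

section \<open>Insertions into regular sequences\<close>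

context pair_digraph
begin

text \<open>At any other position \<open>s\<close> and \<open>t\<close> stay adjacent, and the
  missing arrow survives. In particular, a sequence with two gaps has no path among its
  insertions.\<close>

lemma insertion_in_npaths:
  assumes path: "take i x @ v # drop i x \<in> npaths G m"
    and x: "x = a @ [s, t] @ b" "\<not> arrow s t" and i: "i \<le> length x"
  shows "i = Suc (length a) \<and> arrow s v \<and> arrow v t"
proof -
  \<comment> \<open>The new vertex goes in front of \<open>x ! i\<close>: position
    \<open>length a\<close> is still left of \<open>s\<close>, and \<open>length a + 2\<close> is
    the first one right of \<open>t\<close>.\<close>
  consider "i \<le> length a" | "i = Suc (length a)" | j where "i = length a + 2 + j" "j \<le> length b"
  proof -
    have "i = length a + 2 + (i - length a - 2) \<and> i - length a - 2 \<le> length b"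
      if "\<not> i \<le> length a" "i \<noteq> Suc (length a)"
      using that i x by auto
    then show thesis using that by blast
  qed
  then show ?thesis
  proof cases
    case 1
    then have "take i x @ v # drop i x = (take i a @ v # drop i a) @ [s, t] @ b"
      using x by simp
    then show ?thesis using path x(2) by (simp add: in_npaths_iff successively_append_iff successively_Cons)
  next
    case 2
    then have "take i x @ v # drop i x = a @ [s, v, t] @ b"
      using x by simp
    then show ?thesis using path 2 by (simp only: npath_two_path_iff)
  next
    case 3
    then have "take i x @ v # drop i x = a @ [s, t] @ (take j b @ v # drop j b)"
      using x by simp
    then show ?thesis using path x(2) by (simp add: in_npaths_iff successively_append_iff successively_Cons)
  qed
qed

text \<open>Since \<open>e\<close> vanishes off the paths, only insertions into one gap
  \<open>(s, t)\<close> survive. They share the sign \<open>(-1) ^ k\<close>, and what remains is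
  the balance of \<open>e\<close> at that gap.\<close>

lemma pairing_coboundary:
  fixes e :: "'a list \<Rightarrow> 'f::field"
  assumes e: "balanced e" "\<And>p. p \<notin> npaths G (Suc n) \<Longrightarrow> e p = 0" and g: "g \<in> N_space G n"
  shows "pairing e (coboundary G g) = 0"
proof -
  from g have "Poly_Mapping.keys g \<subseteq> regular_seqs G n - npaths G n" by (simp add: N_space_def)
  then show ?thesis
  proof (induction rule: poly_mapping_support_induct)
    case (single x c)
    then have reg: "length x = Suc n" "set x \<subseteq> pverts G" "successively (\<noteq>) x"
      and "\<not> successively arrow x"
      by (auto simp: in_regular_seqs_iff in_npaths_iff)
    then obtain a s t b where x: "x = a @ [s, t] @ b" "\<not> arrow s t"
      by (elim not_successivelyE)
    \<comment> \<open>Regularity matters: for \<open>s = t\<close> there could be two-paths from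
      \<open>s\<close> back to itself, on which balance imposes nothing. For
      \<open>s \<noteq> t\<close> without an arrow, either the distance is two or no middle vertex
      exists.\<close>
    have "s \<noteq> t" using reg(3) x by (simp add: successively_append_iff)
    define k where "k = Suc (length a)"
    define A where "A = {v. arrow s v \<and> arrow v t}"
    have "(\<Sum>v\<in>A. e (a @ [s, v, t] @ b)) = 0"
    proof (cases "dist_two G s t")
      case True
      then show ?thesis using e(1) unfolding balanced_iff A_def by blast
    next
      case False
      then have "A = {}" using x(2) \<open>s \<noteq> t\<close> by (auto simp: dist_two_iff A_def)
      then show ?thesis by simp
    qed
    moreover have "pairing e (coboundary G (Poly_Mapping.single x c)) =
        (\<Sum>(i, v)\<in>{..length x} \<times> pverts G. (- 1) ^ i * c * e (take i x @ v # drop i x))"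
      by (simp add: coboundary_single pairing_sum case_prod_unfold)
    moreover have "\<dots> = (\<Sum>(i, v)\<in>{k} \<times> A. (- 1) ^ i * c * e (take i x @ v # drop i x))"
    proof (rule sum.mono_neutral_right)
      show "{k} \<times> A \<subseteq> {..length x} \<times> pverts G"
        by (auto simp: A_def k_def x(1) dest: arrow_verts(2))
      have zero: "e (take i x @ v # drop i x) = 0" if "i \<le> length x" "(i, v) \<notin> {k} \<times> A" for i v
      proof (rule e(2), rule notI)
        assume "take i x @ v # drop i x \<in> npaths G (Suc n)"
        from insertion_in_npaths[OF this x that(1)] show False
          using that(2) by (simp add: A_def k_def)
      qed
      show "\<forall>j\<in>{..length x} \<times> pverts G - {k} \<times> A.
        (case j of (i, v) \<Rightarrow> (- 1) ^ i * c * e (take i x @ v # drop i x)) = 0"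
      proof
        fix j assume "j \<in> {..length x} \<times> pverts G - {k} \<times> A"
        moreover obtain i v where "j = (i, v)" by fastforce
        ultimately show "(case j of (i, v) \<Rightarrow> (- 1) ^ i * c * e (take i x @ v # drop i x)) = 0"
          using zero[of i v] by simp
      qed
    qed (simp add: pair_finite_verts)
    moreover have "\<dots> = (\<Sum>v\<in>A. (- 1) ^ k * c * e (a @ [s, v, t] @ b))"
      by (simp add: sum.cartesian_product[symmetric] x k_def)
    ultimately show ?case by (simp flip: sum_distrib_left)
  qed (simp_all add: coboundary_add pairing_add)
qed

lemma J_space_annihilated:
  fixes e :: "'a list \<Rightarrow> 'f::field"
  assumes e: "balanced e" "\<And>p. p \<notin> npaths G n \<Longrightarrow> e p = 0" and f: "f \<in> J_space G n"
  shows "pairing e f = 0"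
proof -
  have N: "pairing e f = 0" if "f \<in> N_space G n" for f
    using that e(2) by (intro pairing_eq_0) (auto simp: N_space_def)
  show ?thesis
  proof (cases n)
    case 0
    then show ?thesis using f N by simp
  next
    case (Suc m)
    then show ?thesis using f N e pairing_coboundary[of e m] by (auto simp: pairing_add)
  qed
qed

lemma insertion_regular_iff:
  assumes x: "x \<in> regular_seqs G n" and "i \<le> length x" "v \<in> pverts G"
  shows "take i x @ v # drop i x \<in> regular_seqs G (Suc n) \<longleftrightarrow>
    \<not> (i < length x \<and> v = x ! i) \<and> \<not> (0 < i \<and> v = x ! (i - 1))"
proof -
  have "successively (\<noteq>) (take i x @ drop i x)" using x by (simp add: in_regular_seqs_iff)
  then have succ: "successively (\<noteq>) (take i x)" "successively (\<noteq>) (drop i x)"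
    unfolding successively_append_iff by blast+
  have "set (take i x) \<union> set (drop i x) = set x" by (metis append_take_drop_id set_append)
  then have verts: "set (take i x) \<subseteq> pverts G" "set (drop i x) \<subseteq> pverts G"
    using x unfolding in_regular_seqs_iff by blast+
  have "take i x \<noteq> [] \<longleftrightarrow> 0 < i" "drop i x \<noteq> [] \<longleftrightarrow> i < length x"
    using x assms(2) by (auto simp: in_regular_seqs_iff)
  moreover have "last (take i x) = x ! (i - 1)" if "0 < i"
    using that assms(2) x by (subst last_conv_nth) (auto simp: in_regular_seqs_iff min_def)
  moreover have "hd (drop i x) = x ! i" if "i < length x"
    using that by (rule hd_drop_conv_nth)
  ultimately show ?thesis
    using succ verts assms x
    by (auto simp: in_regular_seqs_iff successively_append_iff successively_Cons)
qed

text \<open>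
  The irregular insertions come in cancelling pairs: \<open>x\<^sub>i\<close> inserted before and after itself.
\<close>

lemma coboundary_single_regular:
  fixes c :: "'f::field"
  assumes x: "x \<in> regular_seqs G n"
  shows "coboundary G (Poly_Mapping.single x c) =
    (\<Sum>(i, v) | i \<le> length x \<and> v \<in> pverts G \<and> take i x @ v # drop i x \<in> regular_seqs G (Suc n).
      Poly_Mapping.single (take i x @ v # drop i x) ((- 1) ^ i * c))"
proof -
  let ?ins = "\<lambda>i v. take i x @ v # drop i x"
  define h where "h = (\<lambda>(i, v). Poly_Mapping.single (?ins i v) ((- 1) ^ i * c))"
  define D where "D = {..length x} \<times> pverts G"
  define E where "E = {(i, v). i \<le> length x \<and> v \<in> pverts G \<and> ?ins i v \<in> regular_seqs G (Suc n)}"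
  define before where "before = (\<lambda>i. (i, x ! i)) ` {..<length x}"
  define after where "after = (\<lambda>i. (Suc i, x ! i)) ` {..<length x}"
  have nth: "x ! i \<in> pverts G" if "i < length x" for i
    using that x by (auto simp: in_regular_seqs_iff)
  have neq: "x ! Suc i \<noteq> x ! i" if "Suc i < length x" for i
    using that x by (auto simp: regular_seqs_def)
  have diff: "D - E = before \<union> after"
  proof (rule Set.set_eqI)
    fix j :: "nat \<times> 'a"
    obtain i v where j: "j = (i, v)" by fastforce
    have "j \<in> D - E \<longleftrightarrow> i \<le> length x \<and> v \<in> pverts G \<and> ?ins i v \<notin> regular_seqs G (Suc n)"
      by (auto simp: D_def E_def j)
    also have "\<dots> \<longleftrightarrow> i \<le> length x \<and> v \<in> pverts G \<and>
        (i < length x \<and> v = x ! i \<or> 0 < i \<and> v = x ! (i - 1))"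
      using insertion_regular_iff[OF x] by blast
    also have "\<dots> \<longleftrightarrow> j \<in> before \<union> after"
      using nth by (cases i) (auto simp: before_def after_def j)
    finally show "j \<in> D - E \<longleftrightarrow> j \<in> before \<union> after" .
  qed
  have fin: "finite before" "finite after" by (simp_all add: before_def after_def)
  \<comment> \<open>A common element would give \<open>x ! Suc i = x ! i\<close>, against
    regularity.\<close>
  have disj: "before \<inter> after = {}" using neq by (auto simp: before_def after_def)
  have "h (i, x ! i) + h (Suc i, x ! i) = 0" if "i < length x" for i
  proof -
    have "?ins i (x ! i) = ?ins (Suc i) (x ! i)"
      using that by (simp add: take_Suc_conv_app_nth Cons_nth_drop_Suc)
    then show ?thesis by (simp add: h_def flip: single_add)
  qed
  then have "(\<Sum>i<length x. h (i, x ! i)) + (\<Sum>i<length x. h (Suc i, x ! i)) = 0"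
    by (simp flip: sum.distrib)
  moreover have "sum h before = (\<Sum>i<length x. h (i, x ! i))"
    unfolding before_def by (subst sum.reindex) (auto simp: inj_on_def)
  moreover have "sum h after = (\<Sum>i<length x. h (Suc i, x ! i))"
    unfolding after_def by (subst sum.reindex) (auto simp: inj_on_def)
  ultimately have "sum h (D - E) = 0"
    by (simp add: diff sum.union_disjoint disj fin)
  moreover have "finite D" "E \<subseteq> D" using pair_finite_verts by (auto simp: D_def E_def)
  ultimately have "sum h D = sum h E"
    by (simp add: sum.subset_diff)
  then show ?thesis by (simp add: coboundary_single h_def D_def E_def)
qed

text \<open>Deleting \<open>v\<close> leaves a regular non-path, as \<open>x \<noteq> y\<close> and
  there is no arrow. The path terms of its coboundary are the fillings of the gap
  \<open>(x, y)\<close>, and its other terms lie in \<open>N_space G n\<close>.\<close>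

lemma J_space_relation:
  assumes d: "dist_two G x y" and path: "u @ [x, v, y] @ w \<in> npaths G n"
  shows "(\<Sum>p\<in>two_paths G x y. basis_vec (u @ p @ w)) \<in> (J_space G n :: ('a list \<Rightarrow>\<^sub>0 'f::field) set)"
proof -
  obtain m where m: "n = Suc m" using path by (cases n) (auto simp: in_npaths_iff)
  define z where "z = u @ [x, y] @ w"
  define k where "k = Suc (length u)"
  define A where "A = {v. arrow x v \<and> arrow v y}"
  \<comment> \<open>The coefficient \<open>(-1) ^ k\<close> of \<open>z\<close> cancels the sign of
    the insertions at position \<open>k\<close>.\<close>
  define h where "h = (\<lambda>(i, v). Poly_Mapping.single (take i z @ v # drop i z) ((- 1) ^ i * (- 1) ^ k :: 'f))"
  \<comment> \<open>Irregular insertions are cancelled first, because members of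
    \<open>N_space G n\<close> are supported on regular sequences.\<close>
  define E where
    "E = {(i, v). i \<le> length z \<and> v \<in> pverts G \<and> take i z @ v # drop i z \<in> regular_seqs G n}"
  have xy: "x \<noteq> y" "\<not> arrow x y" using d by (auto simp: dist_two_iff)
  have z_reg: "z \<in> regular_seqs G m"
  proof -
    have "u @ [x, v, y] @ w \<in> regular_seqs G n" using path npaths_subset_regular_seqs by blast
    then show ?thesis
      using xy by (auto simp: in_regular_seqs_iff z_def m successively_append_iff)
  qed
  have z_path: "z \<notin> npaths G m"
    using xy by (simp add: in_npaths_iff z_def successively_append_iff)
  have ins_k: "take k z @ v # drop k z = u @ [x, v, y] @ w" for v
    by (simp add: k_def z_def)
  have E_paths: "E \<inter> {(i, v). take i z @ v # drop i z \<in> npaths G n} = {k} \<times> A"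
  proof (intro equalityI subsetI)
    fix j assume "j \<in> E \<inter> {(i, v). take i z @ v # drop i z \<in> npaths G n}"
    then show "j \<in> {k} \<times> A"
      using insertion_in_npaths[OF _ z_def xy(2)] by (auto simp: E_def A_def k_def)
  next
    fix j assume "j \<in> {k} \<times> A"
    then obtain v' where j: "j = (k, v')" "arrow x v'" "arrow v' y" by (auto simp: A_def)
    have p: "u @ [x, v', y] @ w \<in> npaths G n" using path j unfolding npath_two_path_iff by blast
    then have "u @ [x, v', y] @ w \<in> regular_seqs G n" using npaths_subset_regular_seqs by blast
    moreover have "k \<le> length z" by (simp add: k_def z_def)
    ultimately show "j \<in> E \<inter> {(i, v). take i z @ v # drop i z \<in> npaths G n}"
      using p arrow_verts(2)[OF j(2)] by (simp only: j E_def ins_k mem_Collect_eq prod.case Int_iff simp_thms)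
  qed
  have "finite E"
    by (rule finite_subset[of _ "{..length z} \<times> pverts G"]) (auto simp: E_def pair_finite_verts)
  then have "sum h E = sum h ({k} \<times> A) + sum h (E - {(i, v). take i z @ v # drop i z \<in> npaths G n})"
    unfolding E_paths[symmetric] by (rule sum.Int_Diff)
  moreover have "sum h ({k} \<times> A) = (\<Sum>p\<in>two_paths G x y. basis_vec (u @ p @ w))"
  proof -
    have "sum h ({k} \<times> A) = (\<Sum>v\<in>A. h (k, v))"
      by (simp add: sum.cartesian_product')
    also have "\<dots> = (\<Sum>v\<in>A. basis_vec (u @ [x, v, y] @ w))"
      by (simp only: h_def prod.case ins_k) (simp flip: power_mult_distrib)
    finally show ?thesis by (simp add: sum_two_paths A_def)
  qed
  moreover have "coboundary G (Poly_Mapping.single z ((- 1) ^ k)) = sum h E"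
    using coboundary_single_regular[OF z_reg] by (simp add: h_def E_def m)
  ultimately have eq: "(\<Sum>p\<in>two_paths G x y. basis_vec (u @ p @ w)) =
      - sum h (E - {(i, v). take i z @ v # drop i z \<in> npaths G n})
      + coboundary G (Poly_Mapping.single z ((- 1) ^ k))"
    by (simp add: algebra_simps)
  have "sum h (E - {(i, v). take i z @ v # drop i z \<in> npaths G n}) \<in> N_space G n"
    by (rule pm.subspace_sum[OF subspace_N_space]) (auto simp: h_def E_def N_space_def)
  then have "- sum h (E - {(i, v). take i z @ v # drop i z \<in> npaths G n}) \<in> N_space G (Suc m)"
    using pm.subspace_neg[OF subspace_N_space] m by simp
  moreover have "Poly_Mapping.single z ((- 1) ^ k) \<in> N_space G m"
    using z_reg z_path by (simp add: N_space_def)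
  ultimately show ?thesis
    unfolding eq unfolding m J_space.simps by (intro CollectI exI conjI) (rule refl)
qed

lemma Omega_basis:
  assumes "no_multisquares G"
    and P: "CHAR('f) = 2 \<and> complete_reps {C \<in> S_classes G n. thick_class G n C} P \<or>
      CHAR('f) \<noteq> 2 \<and>
        complete_reps {C \<in> S_classes G n. thick_class G n C \<and> bipartite_class G n C} P"
  shows "is_basis (Omega G n :: ('f::field, ('a list \<Rightarrow>\<^sub>0 'f) set) module) P (Omega_class G n)"
proof -
  interpret short_move_quotient G n "J_space G n :: ('a list \<Rightarrow>\<^sub>0 'f) set"
  proof unfold_locales
    show "pairing e f = 0"
      if "balanced e" "\<And>p. p \<notin> npaths G n \<Longrightarrow> e p = 0" "f \<in> J_space G n" for e :: "'a list \<Rightarrow> 'f" and f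
      by (rule J_space_annihilated[OF that])
  qed (use assms(1) subspace_J_space J_space_relation in auto)
  let ?Q = "Omega G n :: ('f, ('a list \<Rightarrow>\<^sub>0 'f) set) module"
  let ?M = "R_space G n :: ('f, 'a list \<Rightarrow>\<^sub>0 'f) module"
  have "is_basis ?Q P (\<lambda>p. J_space G n +>\<^bsub>?M\<^esub> basis_vec p)"
  proof (rule is_basis_reps[OF P])
    show "carrier ?Q = (+>\<^bsub>?M\<^esub>) (J_space G n) ` {f. Poly_Mapping.keys f \<subseteq> regular_seqs G n}"
    proof -
      have "carrier ?M = {f. Poly_Mapping.keys f \<subseteq> regular_seqs G n}"
        by (simp add: R_space_def free_space_def)
      then show ?thesis
        by (auto simp: Omega_def quot_space_def ring.defs FactRing_def A_RCOSETS_def')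
    qed
    show "\<exists>g. Poly_Mapping.keys g \<subseteq> npaths G n \<and> f - g \<in> J_space G n"
      if "f \<in> {f. Poly_Mapping.keys f \<subseteq> regular_seqs G n}" for f :: "'a list \<Rightarrow>\<^sub>0 'f"
    proof (intro exI conjI)
      let ?s = "\<lambda>k. Poly_Mapping.single k (Poly_Mapping.lookup f k)"
      \<comment> \<open>The part of \<open>f\<close> supported on paths; the rest is supported on
        regular non-paths and so lies in \<open>N_space G n\<close>.\<close>
      let ?g = "sum ?s (Poly_Mapping.keys f \<inter> npaths G n)"
      have "?g \<in> {g. Poly_Mapping.keys g \<subseteq> npaths G n}"
        by (rule pm.subspace_sum[OF subspace_keys]) simp
      then show "Poly_Mapping.keys ?g \<subseteq> npaths G n" by simp
      have "f = ?g + sum ?s (Poly_Mapping.keys f - npaths G n)"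
        by (subst (1) poly_mapping_sum_singles) (rule sum.Int_Diff[OF finite_keys])
      then have "f - ?g = sum ?s (Poly_Mapping.keys f - npaths G n)"
        by (metis add_diff_cancel_left')
      moreover have "sum ?s (Poly_Mapping.keys f - npaths G n) \<in> N_space G n"
        by (rule pm.subspace_sum[OF subspace_N_space]) (use that in \<open>auto simp: N_space_def\<close>)
      ultimately show "f - ?g \<in> J_space G n" using N_space_subset_J_space by (metis subsetD)
    qed
    show "basis_vec p \<in> {f. Poly_Mapping.keys f \<subseteq> regular_seqs G n}" if "p \<in> npaths G n" for p
      using that npaths_subset_regular_seqs by auto
  qed (simp_all add: Omega_def quot_space_def ring.defs FactRing_def R_space_def free_space_def subspace_keys)
  then show ?thesis by (simp add: Omega_class_def[abs_def])
qed

end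

theorem corollary4p4:
  fixes G :: "'v pair_pre_digraph" and n :: nat
  assumes "pair_digraph G" and "no_multisquares G"
  shows
    "(CHAR('f::field) = 2 \<longrightarrow>
       (\<forall>P. complete_reps {C \<in> S_classes G n. thick_class G n C} P \<longrightarrow>
          is_basis (Omega G n :: ('f, ('v list \<Rightarrow>\<^sub>0 'f) set) module) P (Omega_class G n) \<and>
          is_basis (path_quotient G n :: ('f, ('v list \<Rightarrow>\<^sub>0 'f) set) module) P
            (\<lambda>p. T_class G (basis_vec p)))) \<and>
     (CHAR('f) \<noteq> 2 \<longrightarrow>
       (\<forall>P. complete_reps {C \<in> S_classes G n. thick_class G n C \<and> bipartite_class G n C} P \<longrightarrow>
          is_basis (Omega G n :: ('f, ('v list \<Rightarrow>\<^sub>0 'f) set) module) P (Omega_class G n) \<and>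
          is_basis (path_quotient G n :: ('f, ('v list \<Rightarrow>\<^sub>0 'f) set) module) P
            (\<lambda>p. T_class G (basis_vec p))))"
  using pair_digraph.Omega_basis[OF assms] pair_digraph.path_quotient_basis[OF assms] by blast

end
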